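(* Let $\alpha$ be a positive integer and $F(z)=1+\sum_{\lambda\ge1}f_\lambda z^\lambda$. Then there is a polynomial $P_\alpha(z)\in\mathbb{Z}[z]$ such that $F(z)\equiv P_\alpha(z)/(1-z)^\alpha$ coefficientwise modulo $11^\alpha$. Moreover, the sequence $(f_\lambda)_{\lambda\ge1}$ reduced modulo $11^\alpha$ is ultimately periodic, with minimal period length equal to $11^{\alpha-1}$.
   Context: $f_\lambda$ denotes the number of free subgroups of index $6\lambda$ in the modular group $\mathrm{PSL}_2(\mathbb{Z})\cong C_2*C_3$. "$F\equiv P/(1-z)^\alpha$ modulo $11^\alpha$" means that the coefficients of $F(z)$ and of the power series $P(z)(1-z)^{-\alpha}$ agree modulo $11^\alpha$. *)

theory Defs
  imports
    "HOL-Analysis.Determinants"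
    "HOL-Algebra.Coset"
    "HOL-Computational_Algebra.Polynomial_FPS"
    "HOL-Number_Theory.Cong"
begin

definition SL2Z :: "(int^2^2) monoid" where
  "SL2Z = \<lparr>carrier = {A. det A = 1}, monoid.mult = (**), one = mat 1\<rparr>"

definition PSL2Z :: "(int^2^2) set monoid" where
  "PSL2Z = SL2Z Mod {mat 1, - mat 1}"

text \<open>
  A word is a list of letters: \<open>(True, s)\<close> stands for \<open>s\<close> and \<open>(False, s)\<close> for the formal
  inverse of \<open>s\<close>.  It is reduced if no letter is adjacent to its formal inverse.
\<close>

definition reduced_words :: "'a set \<Rightarrow> (bool \<times> 'a) list set" where
  "reduced_words S =
     {w. snd ` set w \<subseteq> S \<and>
         (\<forall>i. Suc i < length w \<longrightarrow> \<not> (snd (w ! i) = snd (w ! Suc i) \<and> fst (w ! i) \<noteq> fst (w ! Suc i)))}"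

fun word_eval :: "('a, 'b) monoid_scheme \<Rightarrow> (bool \<times> 'a) list \<Rightarrow> 'a" where
  "word_eval G [] = \<one>\<^bsub>G\<^esub>"
| "word_eval G ((b, s) # w) = (if b then s else inv\<^bsub>G\<^esub> s) \<otimes>\<^bsub>G\<^esub> word_eval G w"

text \<open>
  A group is free on \<open>S\<close> if each of its elements is the value of exactly one reduced word in \<open>S\<close>.
\<close>

definition free_on :: "('a, 'b) monoid_scheme \<Rightarrow> 'a set \<Rightarrow> bool" where
  "free_on G S \<longleftrightarrow> S \<subseteq> carrier G \<and> bij_betw (word_eval G) (reduced_words S) (carrier G)"

definition free_group :: "('a, 'b) monoid_scheme \<Rightarrow> bool" where
  "free_group G \<longleftrightarrow> group G \<and> (\<exists>S. free_on G S)"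

definition free_subgroups_of_index :: "('a, 'b) monoid_scheme \<Rightarrow> nat \<Rightarrow> 'a set set" where
  "free_subgroups_of_index G n =
     {H. subgroup H G \<and> finite (rcosets\<^bsub>G\<^esub> H) \<and> card (rcosets\<^bsub>G\<^esub> H) = n \<and>
         free_group (G\<lparr>carrier := H\<rparr>)}"

definition num_free_subgroups :: "nat \<Rightarrow> nat" where
  "num_free_subgroups l = card (free_subgroups_of_index PSL2Z (6 * l))"

definition free_subgroup_gf :: "int fps" where
  "free_subgroup_gf = 1 + Abs_fps (\<lambda>l. if l \<ge> 1 then int (num_free_subgroups l) else 0)"

definition fps_cong :: "int fps \<Rightarrow> int fps \<Rightarrow> int \<Rightarrow> bool" where
  "fps_cong A B m \<longleftrightarrow> (\<forall>n. [fps_nth A n = fps_nth B n] (mod m))"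

definition eventual_period :: "(nat \<Rightarrow> 'a) \<Rightarrow> nat \<Rightarrow> bool" where
  "eventual_period g p \<longleftrightarrow> p > 0 \<and> (\<exists>N. \<forall>n\<ge>N. g (n + p) = g n)"

definition ultimately_periodic :: "(nat \<Rightarrow> 'a) \<Rightarrow> bool" where
  "ultimately_periodic g \<longleftrightarrow> (\<exists>p. eventual_period g p)"

definition minimal_period :: "(nat \<Rightarrow> 'a) \<Rightarrow> nat" where
  "minimal_period g = (LEAST p. eventual_period g p)"

end

(*
  A subgroup of the modular group is free of finite index exactly if it contains no conjugate of the
  two standard generators s, u of orders 2 and 3, i.e. if s and u permute its cosets without fixed
  points.  Labelling cosets therefore turns free subgroups into orbits of pairs of fixed-point free
  permutations of orders 2 and 3, and splitting such a pair at the orbit of a base point gives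
  6 n h_n = sum_{l=1}^{n} f_l h_{n-l} with h_n = (6n)! / ((3n)! (2n)! 72^n).
  Modulo 11^a the series H = sum h_n z^n is a polynomial 1 - z + 11 G, because n! divides
  (6n)! / ((3n)! (2n)!).  Hence F - 1 = 6 z H'/H = sum_i 11^i A_i / (1-z)^(i+1) with polynomials
  A_i = 6 z H' (-G)^i.  Only the term i = 1 contributes to f_{n+11^e} - f_n modulo 11^(e+2), and its
  contribution is 11^(e+1) times a unit since H(1) = 66 modulo 121.
*)
theory Submission
  imports Defs "HOL-Combinatorics.Permutations"
begin

section \<open>Torsion in free groups\<close>

text \<open>The prime 11 is special because h_{n+1} / h_n = (6n+5)(6n+1) / (6(n+1)): at n = 1 the
  numerator is 11 times 7, no denominator removes this 11 up to h_10, and from n = 11 on the factor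
  n! supplies one. The powers of 72 count symmetries of cycles; as 72 is a unit modulo 11, the
  rational h_n become integers once 1/72 is replaced by an inverse modulo 11^a. Freeness is defined
  by unique reduced words, so the hard half of the criterion is uniqueness. It comes from an action
  on a model of the universal cover; the group itself enters only through normal forms in s and u,
  which turn any two permutations satisfying the two relations into an action. Multiplication by 1 -
  z^q with q = 11^e produces differences of coefficients. When 1 - z^q is expanded in powers of 1 -
  z, only the powers j \<le> i leave a pole in 11^i / (1-z)^(i+1), and their binomial coefficients
  are almost divisible by q. The resulting congruence is used twice: e = \<alpha> - 1 gives a
  period, e = \<alpha> - 2 excludes all its proper divisors.\<close>

definition no_cancel :: "bool \<times> 'a \<Rightarrow> bool \<times> 'a \<Rightarrow> bool" where
  "no_cancel x y \<longleftrightarrow> \<not> (snd x = snd y \<and> fst x \<noteq> fst y)"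

lemma reduced_words_iff:
  "w \<in> reduced_words S \<longleftrightarrow> snd ` set w \<subseteq> S \<and> successively no_cancel w"
  unfolding reduced_words_def successively_conv_nth no_cancel_def by auto

lemma (in group) word_eval_append:
  assumes "snd ` set v \<subseteq> carrier G" "snd ` set w \<subseteq> carrier G"
  shows "word_eval G v \<in> carrier G \<and> word_eval G (v @ w) = word_eval G v \<otimes> word_eval G w"
proof -
  have c: "word_eval G w \<in> carrier G" if "snd ` set w \<subseteq> carrier G" for w
    using that by (induction w) auto
  show ?thesis using assms(1)
  proof (induction v)
    case Nil
    then show ?case using c[OF assms(2)] by simp
  next
    case (Cons l v)
    then show ?case using c[OF assms(2)] c[of v] by (cases l) (auto simp: m_assoc)
  qed
qed

lemma (in group) word_eval_closed:
  "snd ` set w \<subseteq> carrier G \<Longrightarrow> word_eval G w \<in> carrier G"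
  using word_eval_append[of w "[]"] by simp

lemma (in group) inv_conj_cube_eq_one:
  assumes "l \<in> carrier G" "x \<in> carrier G" "y = l \<otimes> x \<otimes> inv l"
    and "y \<otimes> y = \<one> \<or> y \<otimes> y \<otimes> y = \<one>"
  shows "x \<otimes> x = \<one> \<or> x \<otimes> x \<otimes> x = \<one>"
proof -
  have x: "x = inv l \<otimes> y \<otimes> l" and y: "y \<in> carrier G"
    using assms by (simp_all add: m_assoc inv_solve_left)
  have c: "l \<otimes> (inv l \<otimes> z) = z" if "z \<in> carrier G" for z
    using that assms(1) by (simp add: m_assoc[symmetric])
  have 2: "x \<otimes> x = inv l \<otimes> (y \<otimes> y) \<otimes> l"
    unfolding x using assms(1) y by (simp add: m_assoc c)
  have 3: "x \<otimes> x \<otimes> x = inv l \<otimes> (y \<otimes> y \<otimes> y) \<otimes> l"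
    unfolding 2 unfolding x using assms(1) y by (simp add: m_assoc c)
  from assms(4) show ?thesis
  proof
    assume "y \<otimes> y = \<one>"
    then show ?thesis using 2 assms(1) by simp
  next
    assume "y \<otimes> y \<otimes> y = \<one>"
    then show ?thesis using 3 assms(1) by simp
  qed
qed

text \<open>If the first and last letters of \<open>w\<close> do not cancel, then
  \<open>w @ w\<close> and \<open>w @ w @ w\<close> are again reduced; one of them has the value 1
  of the empty word and hence is empty. Otherwise \<open>x\<close> is a conjugate of the value of
  the word without its end letters, and conjugation preserves the torsion relation.\<close>

lemma (in group) free_on_word_torsion_free:
  assumes "free_on G S" "w \<in> reduced_words S" "x = word_eval G w"
    and "x \<otimes> x = \<one> \<or> x \<otimes> x \<otimes> x = \<one>"
  shows "x = \<one>"
  using assms(2-)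
proof (induction "length w" arbitrary: w x rule: less_induct)
  case less
  have S: "S \<subseteq> carrier G" and inj: "inj_on (word_eval G) (reduced_words S)"
    using assms(1) unfolding free_on_def bij_betw_def by auto
  have red: "snd ` set w \<subseteq> S" "successively no_cancel w"
    using less.prems(1) unfolding reduced_words_iff by auto
  then have wS: "snd ` set w \<subseteq> carrier G" using S by auto
  have x: "x \<in> carrier G" using less.prems(2) word_eval_closed[OF wS] by simp
  show ?case
  proof (cases "w = []")
    case True
    then show ?thesis using less.prems by simp
  next
    case False
    show ?thesis
    proof (cases "no_cancel (last w) (hd w)")
      case True
      define v where "v = (if x \<otimes> x = \<one> then w @ w else w @ w @ w)"
      have "v \<in> reduced_words S"
        unfolding reduced_words_iff v_def using red True False
        by (auto simp: successively_append_iff)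
      moreover have "word_eval G v = word_eval G []"
        unfolding v_def using word_eval_append[of w w] word_eval_append[of w "w @ w"] wS less.prems(2,3) x
        by (auto simp: m_assoc)
      moreover have "[] \<in> reduced_words S"
        by (simp add: reduced_words_iff)
      ultimately have "v = []" using inj unfolding inj_on_def by blast
      then show ?thesis using False by (auto simp: v_def split: if_splits)
    next
      case F: False
      then have c: "snd (last w) = snd (hd w)" "fst (last w) \<noteq> fst (hd w)"
        by (auto simp: no_cancel_def)
      from False obtain l w' where w: "w = l # w'" by (cases w) auto
      with c have "w' \<noteq> []" by auto
      then obtain w'' l' where w': "w' = w'' @ [l']" by (cases w' rule: rev_cases) auto
      obtain b e where l: "l = (b, e)" by (cases l)
      have l': "l' = (\<not> b, e)" using c unfolding w w' l by (cases l') auto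
      define y where "y = word_eval G w''"
      have w''S: "snd ` set w'' \<subseteq> carrier G" and e: "e \<in> carrier G"
        using wS unfolding w w' l by auto
      have y: "y \<in> carrier G" unfolding y_def by (rule word_eval_closed[OF w''S])
      define t where "t = (if b then e else inv e)"
      have t: "t \<in> carrier G" using e by (auto simp: t_def)
      have "word_eval G w = t \<otimes> (y \<otimes> inv t)"
        unfolding w w' l l' y_def t_def using word_eval_append[OF w''S, of "[(\<not> b, e)]"] e
        by auto
      then have eq: "x = t \<otimes> y \<otimes> inv t"
        using less.prems(2) t y by (simp add: m_assoc)
      have "y = \<one>"
      proof (rule less.hyps)
        show "length w'' < length w" by (simp add: w w')
        show "w'' \<in> reduced_words S" using red unfolding w w' reduced_words_iff
          by (auto simp: successively_append_iff successively_Cons)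
        show "y = word_eval G w''" by (simp add: y_def)
        show "y \<otimes> y = \<one> \<or> y \<otimes> y \<otimes> y = \<one>"
          by (rule inv_conj_cube_eq_one[OF t y eq less.prems(3)])
      qed
      then show ?thesis using eq t by simp
    qed
  qed
qed

lemma free_group_torsion_free:
  assumes "free_group K" "x \<in> carrier K"
    and "x \<otimes>\<^bsub>K\<^esub> x = \<one>\<^bsub>K\<^esub> \<or> x \<otimes>\<^bsub>K\<^esub> x \<otimes>\<^bsub>K\<^esub> x = \<one>\<^bsub>K\<^esub>"
  shows "x = \<one>\<^bsub>K\<^esub>"
proof -
  obtain S where S: "group K" "free_on K S" using assms(1) unfolding free_group_def by auto
  then obtain w where "w \<in> reduced_words S" "x = word_eval K w"
    using assms(2) unfolding free_on_def bij_betw_def by auto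
  then show ?thesis using group.free_on_word_torsion_free[OF S] assms(3) by blast
qed

section \<open>Groups generated by elements of orders 2 and 3\<close>

text \<open>These are the normal forms of a free product of groups of orders 2 and 3, with
  \<open>True\<close> for \<open>s\<close> and \<open>False\<close> for \<open>u\<close>. No
  inverses are needed, since the inverse of \<open>u\<close> is spelled \<open>u u\<close>.\<close>

definition alternating :: "bool list \<Rightarrow> bool" where
  "alternating w \<longleftrightarrow> \<not> (\<exists>p q. w = p @ [True, True] @ q \<or> w = p @ [False, False, False] @ q)"

fun gen_eval :: "('a, 'b) monoid_scheme \<Rightarrow> 'a \<Rightarrow> 'a \<Rightarrow> bool list \<Rightarrow> 'a" where
  "gen_eval G s u [] = \<one>\<^bsub>G\<^esub>"
| "gen_eval G s u (b # w) = (if b then s else u) \<otimes>\<^bsub>G\<^esub> gen_eval G s u w"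

text \<open>
  Words act from the right, as the group does on the right cosets of a subgroup.
\<close>

definition run :: "('x \<Rightarrow> 'x) \<Rightarrow> ('x \<Rightarrow> 'x) \<Rightarrow> bool list \<Rightarrow> 'x \<Rightarrow> 'x" where
  "run \<sigma> \<tau> = fold (\<lambda>b. if b then \<sigma> else \<tau>)"

lemma run_simps [simp]:
  "run \<sigma> \<tau> [] x = x"
  "run \<sigma> \<tau> (b # w) x = run \<sigma> \<tau> w (if b then \<sigma> x else \<tau> x)"
  "run \<sigma> \<tau> (v @ w) x = run \<sigma> \<tau> w (run \<sigma> \<tau> v x)"
  by (simp_all add: run_def)

definition modular_action :: "('x \<Rightarrow> 'x) \<Rightarrow> ('x \<Rightarrow> 'x) \<Rightarrow> bool" where
  "modular_action \<sigma> \<tau> \<longleftrightarrow> (\<forall>x. \<sigma> (\<sigma> x) = x) \<and> (\<forall>x. \<tau> (\<tau> (\<tau> x)) = x)"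

text \<open>An internal description of the free product of the groups generated by \<open>s\<close>
  and \<open>u\<close>: the relations and \<open>generated\<close> reduce every element to a normal
  form, and \<open>faithful\<close> says that no nonempty normal form is trivial.\<close>

locale modular_generators = group G for G (structure) +
  fixes s u
  assumes s_closed [simp]: "s \<in> carrier G"
    and u_closed [simp]: "u \<in> carrier G"
    and s_square: "s \<otimes> s = \<one>"
    and u_cube: "u \<otimes> u \<otimes> u = \<one>"
    and generated: "g \<in> carrier G \<Longrightarrow> \<exists>w. gen_eval G s u w = g"
    and faithful: "alternating w \<Longrightarrow> gen_eval G s u w = \<one> \<Longrightarrow> w = []"
begin

abbreviation ev :: "bool list \<Rightarrow> 'a" where "ev \<equiv> gen_eval G s u"

lemma ev_closed [simp]: "ev w \<in> carrier G"
  by (induction w) auto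

lemma ev_append: "ev (v @ w) = ev v \<otimes> ev w"
  by (induction v) (auto simp: m_assoc)

text \<open>This is the universal property of the free product. Deleting \<open>s s\<close> or
  \<open>u u u\<close> changes neither the value of a word nor its effect on points. When no
  deletion is possible the word is a normal form of value 1, hence empty.\<close>

lemma run_trivial:
  assumes "modular_action \<sigma> \<tau>" "ev w = \<one>"
  shows "run \<sigma> \<tau> w x = x"
  using assms(2)
proof (induction "length w" arbitrary: w rule: less_induct)
  case less
  show ?case
  proof (cases "alternating w")
    case True
    then show ?thesis using faithful[OF _ less.prems] by simp
  next
    case False
    then consider p q where "w = p @ [True, True] @ q"
      | p q where "w = p @ [False, False, False] @ q"
      unfolding alternating_def by blast
    then show ?thesis
    proof cases
      case 1
      have "ev (p @ q) = \<one>"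
        using less.prems unfolding 1
        by (simp add: ev_append m_assoc[symmetric] s_square)
      then have "run \<sigma> \<tau> (p @ q) x = x" by (intro less.hyps) (simp_all add: 1)
      then show ?thesis using assms(1) by (simp add: 1 modular_action_def)
    next
      case 2
      have "u \<otimes> (u \<otimes> (u \<otimes> ev q)) = ev q"
        using u_cube by (simp add: m_assoc[symmetric])
      then have "ev (p @ q) = \<one>"
        using less.prems unfolding 2 by (simp add: ev_append)
      then have "run \<sigma> \<tau> (p @ q) x = x" by (intro less.hyps) (simp_all add: 2)
      then show ?thesis using assms(1) by (simp add: 2 modular_action_def)
    qed
  qed
qed

lemma run_eqI:
  assumes "modular_action \<sigma> \<tau>" "ev v = ev w"
  shows "run \<sigma> \<tau> v x = run \<sigma> \<tau> w x"
proof -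
  \<comment> \<open>With \<open>v'\<close> spelling the inverse, both \<open>v @ v'\<close> and
    \<open>v' @ w\<close> have value 1. Running the second from the point
    \<open>run \<sigma> \<tau> v x\<close> passes through \<open>x\<close> and shows that
    \<open>w\<close> takes \<open>x\<close> to the same point as \<open>v\<close>.\<close>
  obtain v' where v': "ev v' = inv (ev v)" using generated[of "inv (ev v)"] by auto
  have "run \<sigma> \<tau> (v @ v') x = x" "run \<sigma> \<tau> (v' @ w) (run \<sigma> \<tau> v x) = run \<sigma> \<tau> v x"
    using assms v' by (intro run_trivial; simp add: ev_append)+
  then show ?thesis by simp
qed

text \<open>By \<open>run_eqI\<close> the choice of the word is immaterial for a modular action. The
  action is a right action, so \<open>act_mult\<close> reverses the order of composition.\<close>

definition act :: "('x \<Rightarrow> 'x) \<Rightarrow> ('x \<Rightarrow> 'x) \<Rightarrow> 'a \<Rightarrow> 'x \<Rightarrow> 'x" where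
  "act \<sigma> \<tau> g = run \<sigma> \<tau> (SOME w. ev w = g)"

lemma act_ev: "modular_action \<sigma> \<tau> \<Longrightarrow> act \<sigma> \<tau> (ev w) x = run \<sigma> \<tau> w x"
  unfolding act_def by (rule run_eqI) (auto intro: someI)

context
  fixes \<sigma> \<tau> :: "'x \<Rightarrow> 'x"
  assumes mod: "modular_action \<sigma> \<tau>"
begin

lemma act_mult:
  assumes "g \<in> carrier G" "h \<in> carrier G"
  shows "act \<sigma> \<tau> (g \<otimes> h) x = act \<sigma> \<tau> h (act \<sigma> \<tau> g x)"
proof -
  obtain v w where "g = ev v" "h = ev w" using generated assms by metis
  then show ?thesis
    using act_ev[OF mod, of "v @ w"] act_ev[OF mod, of v] act_ev[OF mod, of w] by (simp add: ev_append)
qed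

lemma act_one [simp]: "act \<sigma> \<tau> \<one> x = x"
  using act_ev[OF mod, of "[]"] by simp

lemma act_s [simp]: "act \<sigma> \<tau> s x = \<sigma> x"
  using act_ev[OF mod, of "[True]"] by simp

lemma act_u [simp]: "act \<sigma> \<tau> u x = \<tau> x"
  using act_ev[OF mod, of "[False]"] by simp

lemma act_inv [simp]: "g \<in> carrier G \<Longrightarrow> act \<sigma> \<tau> (inv g) (act \<sigma> \<tau> g x) = x"
  by (subst act_mult[symmetric]) auto

lemma act_inv' [simp]: "g \<in> carrier G \<Longrightarrow> act \<sigma> \<tau> g (act \<sigma> \<tau> (inv g) x) = x"
  by (subst act_mult[symmetric]) auto

end

lemma s_ne_one: "s \<noteq> \<one>"
proof
  assume "s = \<one>"
  then have "ev [True] = \<one>" by simp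
  moreover have "alternating [True]"
    by (auto simp: alternating_def Cons_eq_append_conv)
  ultimately show False using faithful by blast
qed

lemma u_ne_one: "u \<noteq> \<one>"
proof
  assume "u = \<one>"
  then have "ev [False] = \<one>" by simp
  moreover have "alternating [False]"
    by (auto simp: alternating_def Cons_eq_append_conv)
  ultimately show False using faithful by blast
qed

definition avoids_torsion :: "'a set \<Rightarrow> bool" where
  "avoids_torsion H \<longleftrightarrow> (\<forall>g\<in>carrier G. g \<otimes> s \<otimes> inv g \<notin> H \<and> g \<otimes> u \<otimes> inv g \<notin> H)"

lemma free_avoids_torsion:
  assumes "free_group (G\<lparr>carrier := H\<rparr>)"
  shows "avoids_torsion H"
  unfolding avoids_torsion_def
proof (intro ballI conjI)
  fix g assume g [simp]: "g \<in> carrier G"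
  have sc: "s \<otimes> (s \<otimes> x) = x" "u \<otimes> (u \<otimes> (u \<otimes> x)) = x"  if "x \<in> carrier G" for x
    using that s_square u_cube by (simp_all add: m_assoc[symmetric])
  have ic: "inv g \<otimes> (g \<otimes> x) = x" if "x \<in> carrier G" for x
    using that by (simp add: m_assoc[symmetric])
  show "g \<otimes> s \<otimes> inv g \<notin> H"
  proof
    assume a: "g \<otimes> s \<otimes> inv g \<in> H"
    have "(g \<otimes> s \<otimes> inv g) \<otimes> (g \<otimes> s \<otimes> inv g) = \<one>"
      by (simp add: m_assoc ic sc)
    then have "g \<otimes> s \<otimes> inv g = \<one>"
      using free_group_torsion_free[OF assms, of "g \<otimes> s \<otimes> inv g"] a by simp
    then show False
      using s_ne_one ic[of s] by (metis g inv_closed inv_equality inv_inv l_cancel_one' m_closed s_closed)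
  qed
  show "g \<otimes> u \<otimes> inv g \<notin> H"
  proof
    assume a: "g \<otimes> u \<otimes> inv g \<in> H"
    have "(g \<otimes> u \<otimes> inv g) \<otimes> (g \<otimes> u \<otimes> inv g) \<otimes> (g \<otimes> u \<otimes> inv g) = \<one>"
      by (simp add: m_assoc ic sc)
    then have "g \<otimes> u \<otimes> inv g = \<one>"
      using free_group_torsion_free[OF assms, of "g \<otimes> u \<otimes> inv g"] a by simp
    then show False
      using u_ne_one ic[of u] by (metis g inv_closed inv_equality inv_inv l_cancel_one' m_closed u_closed)
  qed
qed

end

section \<open>Torsion-free subgroups of finite index are free\<close>

lemma (in group) rcosets_r_coset:
  assumes "subgroup H G" "C \<in> rcosets H" "g \<in> carrier G"
  shows "C #> g \<in> rcosets H"
  using assms subgroup.subset[OF assms(1)] by (auto simp: RCOSETS_def coset_mult_assoc)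

lemma (in group) r_coset_eq_iff:
  assumes "subgroup H G" "x \<in> carrier G" "y \<in> carrier G"
  shows "H #> x = H #> y \<longleftrightarrow> x \<otimes> inv y \<in> H"
proof -
  have "H #> x = H #> y \<longleftrightarrow> x \<in> H #> y"
    using repr_independence[OF _ assms(3,1), of x] rcos_self[OF assms(2,1)] by auto
  also have "\<dots> \<longleftrightarrow> x \<otimes> inv y \<in> H"
    using subgroup.rcos_module[OF assms(1) is_group assms(3,2)] .
  finally show ?thesis .
qed

lemma (in group) rcosets_cases:
  assumes "subgroup H G" "C \<in> rcosets H"
  obtains g where "g \<in> carrier G" "C = H #> g" 
  using assms by (auto simp: RCOSETS_def)

lemma (in group) rcosets_subset:
  assumes "subgroup H G" "C \<in> rcosets H"
  shows "C \<subseteq> carrier G"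
  using assms r_coset_subset_G[OF subgroup.subset] by (auto simp: RCOSETS_def)

text \<open>Left multiplication by a letter in the free group, modelled on reduced words.\<close>

definition push :: "bool \<times> 'a \<Rightarrow> (bool \<times> 'a) list \<Rightarrow> (bool \<times> 'a) list" where
  "push l w = (if w = [] \<or> no_cancel l (hd w) then l # w else tl w)"

lemma no_cancel_commute: "no_cancel x y \<longleftrightarrow> no_cancel y x"
  by (auto simp: no_cancel_def)

lemma successively_push:
  assumes "successively no_cancel w"
  shows "successively no_cancel (push l w)"
  using assms by (cases w) (auto simp: push_def successively_Cons)

text \<open>If the inner \<open>push\<close> cancels the first letter of \<open>w\<close>, the outer
  one puts it back: as \<open>w\<close> is reduced, its second letter cannot cancel against it. Thus
  letters permute the reduced words, which will make crossing an edge twice trivial.\<close>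

lemma push_push_inverse:
  assumes "successively no_cancel w"
  shows "push (b, e) (push (\<not> b, e) w) = w"
  using assms by (cases w) (auto simp: push_def successively_Cons no_cancel_def)

context modular_generators
begin

lemma
  assumes "subgroup H G" "C \<in> rcosets H"
  shows coset_s_in: "C #> s \<in> rcosets H" and coset_u_in: "C #> u \<in> rcosets H"
    and coset_s_s: "C #> s #> s = C" and coset_u_u_u: "C #> u #> u #> u = C"
  using rcosets_r_coset[OF assms] rcosets_subset[OF assms]
  by (simp_all add: coset_mult_assoc s_square u_cube m_assoc[symmetric])

lemma
  assumes H: "subgroup H G" and C: "C \<in> rcosets H" and a: "avoids_torsion H"
  shows coset_s_ne: "C #> s \<noteq> C" and coset_u_ne: "C #> u \<noteq> C"
proof -
  obtain g where g: "g \<in> carrier G" "C = H #> g" using rcosets_cases[OF H C] .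
  have "H #> g #> x \<noteq> H #> g" if "g \<otimes> x \<otimes> inv g \<notin> H" "x \<in> carrier G" for x
    using that g(1) subgroup.subset[OF H] r_coset_eq_iff[OF H, of "g \<otimes> x" g]
    by (simp add: coset_mult_assoc)
  then show "C #> s \<noteq> C" "C #> u \<noteq> C"
    using a g unfolding avoids_torsion_def by auto
qed

section \<open>Coset representatives along a spanning tree\<close>

definition transversal_on :: "'a set \<Rightarrow> 'a set set \<Rightarrow> ('a set \<Rightarrow> 'a) \<Rightarrow> bool" where
  "transversal_on H Y t \<longleftrightarrow> Y \<subseteq> rcosets H \<and>
    (\<forall>C\<in>Y. C #> u \<in> Y \<and> t C \<in> carrier G \<and> H #> t C = C \<and> t (C #> u) = t C \<otimes> u)"

text \<open>As \<open>u\<close> fixes no coset and has order 3, the orbit of \<open>C\<close>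
  consists of three cosets, and it misses \<open>Y\<close> because \<open>Y\<close> is closed under
  \<open>u\<close>. The representatives \<open>g\<close>, \<open>g \<otimes> u\<close>,
  \<open>g \<otimes> u \<otimes> u\<close> can therefore be assigned freely, and
  \<open>u_cube\<close> closes the cycle.\<close>

lemma transversal_on_extend:
  assumes H: "subgroup H G" and a: "avoids_torsion H"
    and t: "transversal_on H Y t" and C: "C \<in> rcosets H" "C \<notin> Y"
    and g: "g \<in> carrier G" "H #> g = C"
  obtains t' where "transversal_on H (insert C (insert (C #> u) (insert (C #> u #> u) Y))) t'"
    "\<And>D. D \<in> Y \<Longrightarrow> t' D = t D" "t' C = g"
proof -
  define C1 C2 where "C1 = C #> u" and "C2 = C1 #> u"
  have C1: "C1 \<in> rcosets H" and C2: "C2 \<in> rcosets H"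
    unfolding C1_def C2_def using coset_u_in[OF H] C(1) by blast+
  have C2u: "C2 #> u = C" unfolding C1_def C2_def by (rule coset_u_u_u[OF H C(1)])
  have ne: "C \<noteq> C1" "C1 \<noteq> C2" "C \<noteq> C2"
    using coset_u_ne[OF H C(1) a] coset_u_ne[OF H C1 a] coset_u_ne[OF H C2 a] C2u
    by (auto simp: C1_def[symmetric] C2_def[symmetric])
  have Yu: "D #> u \<in> Y" if "D \<in> Y" for D using t that unfolding transversal_on_def by auto
  have nY: "C1 \<notin> Y" "C2 \<notin> Y"
    using Yu[of C1] Yu[of C2] C2u C(2) by (auto simp: C2_def[symmetric])
  define t' where "t' = t(C := g, C1 := g \<otimes> u, C2 := g \<otimes> u \<otimes> u)"
  have H1: "H #> (g \<otimes> u) = C1" "H #> (g \<otimes> u \<otimes> u) = C2"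
    unfolding C2_def C1_def g(2)[symmetric] using g(1) subgroup.subset[OF H]
    by (simp_all add: coset_mult_assoc m_assoc)
  have gu: "g \<otimes> u \<otimes> u \<otimes> u = g" using g(1) u_cube by (simp add: m_assoc)
  have "transversal_on H (insert C (insert C1 (insert C2 Y))) t'"
    unfolding transversal_on_def
  proof (intro conjI ballI)
    show "insert C (insert C1 (insert C2 Y)) \<subseteq> rcosets H"
      using t C C1 C2 unfolding transversal_on_def by auto
  next
    fix D assume "D \<in> insert C (insert C1 (insert C2 Y))"
    then consider "D = C" | "D = C1" | "D = C2" | "D \<in> Y" "D \<noteq> C" "D \<noteq> C1" "D \<noteq> C2" using nY C by auto
    note D = this
    show "D #> u \<in> insert C (insert C1 (insert C2 Y))"
      using D C2u Yu[of D] unfolding C2_def C1_def by cases simp_all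
    show "t' D \<in> carrier G"
      using D g(1) t unfolding transversal_on_def t'_def by cases simp_all
    show "H #> t' D = D"
    proof (use D in cases)
      case 4
      then have "t' D = t D" by (simp add: t'_def)
      moreover have "H #> t D = D" using t 4(1) unfolding transversal_on_def by blast
      ultimately show ?thesis by metis
    next
      case 1
      then have "t' D = g" using ne by (simp add: t'_def)
      then show ?thesis using 1 g(2) by metis
    next
      case 2
      then have "t' D = g \<otimes> u" using ne by (simp add: t'_def)
      then show ?thesis using 2 H1(1) by metis
    next
      case 3
      then have "t' D = g \<otimes> u \<otimes> u" using ne by (simp add: t'_def)
      then show ?thesis using 3 H1(2) by metis
    qed
    show "t' (D #> u) = t' D \<otimes> u"
      using D
    proof cases
      case 4
      then have "D #> u \<noteq> C" "D #> u \<noteq> C1" "D #> u \<noteq> C2" using Yu nY C by auto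
      then show ?thesis using 4 t by (auto simp: t'_def transversal_on_def)
    qed (use ne in \<open>auto simp: t'_def C1_def[symmetric] C2_def[symmetric] C2u gu\<close>)
  qed
  moreover have "t' D = t D" if "D \<in> Y" for D using that nY C by (auto simp: t'_def)
  moreover have "t' C = g" using ne by (auto simp: t'_def)
  ultimately show ?thesis using that unfolding C1_def C2_def by blast
qed

text \<open>
  The cosets form a graph whose vertices are the orbits of \<open>u\<close> and whose edges are the orbits of
  \<open>s\<close>.  The edges with \<open>t (C #> s) = t C \<otimes> s\<close> make up a spanning tree; that it spans is expressed as
  an induction principle.
\<close>

definition tree_closed :: "'a set set \<Rightarrow> ('a set \<Rightarrow> 'a) \<Rightarrow> ('a set \<Rightarrow> bool) \<Rightarrow> bool" where
  "tree_closed Y t P \<longleftrightarrow> (\<forall>C\<in>Y. P C \<longrightarrow> P (C #> u)) \<and>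
    (\<forall>C\<in>Y. P C \<longrightarrow> C #> s \<in> Y \<longrightarrow> t (C #> s) = t C \<otimes> s \<longrightarrow> P (C #> s))"

definition tree_transversal_on :: "'a set \<Rightarrow> 'a set set \<Rightarrow> ('a set \<Rightarrow> 'a) \<Rightarrow> bool" where
  "tree_transversal_on H Y t \<longleftrightarrow> transversal_on H Y t \<and> H \<in> Y \<and> t H = \<one> \<and>
     (\<forall>P. P H \<longrightarrow> tree_closed Y t P \<longrightarrow> (\<forall>C\<in>Y. P C))"

text \<open>The tree grows by one \<open>u\<close>-orbit at a time. Since \<open>s\<close> and
  \<open>u\<close> generate \<open>G\<close>, a proper part of the cosets that contains
  \<open>H\<close> and is closed under \<open>u\<close> cannot be closed under \<open>s\<close>, so
  some edge leaves it; the orbit at its far end is added with a representative that makes this edge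
  a tree edge. Finiteness of the number of cosets stops the growth.\<close>

lemma tree_transversal_exists:
  assumes H: "subgroup H G" and a: "avoids_torsion H" and fin: "finite (rcosets H)"
  obtains t where "tree_transversal_on H (rcosets H) t"
proof -
  let ?R = "rcosets H"
  have HR: "H \<in> ?R" using subgroup.subgroup_in_rcosets[OF H is_group] .
  have "\<exists>Y t. tree_transversal_on H Y t \<and> (Y = ?R \<or> n \<le> card Y)" for n
  proof (induction n)
    case 0
    have "transversal_on H {} (\<lambda>_. \<one>)" by (simp add: transversal_on_def)
    from transversal_on_extend[OF H a this HR _ one_closed]
    obtain t where t: "transversal_on H {H, H #> u, H #> u #> u} t" "t H = \<one>"
      using subgroup.subset[OF H] by auto
    have "tree_transversal_on H {H, H #> u, H #> u #> u} t"
      using t by (auto simp: tree_transversal_on_def tree_closed_def)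
    then show ?case by auto
  next
    case (Suc n)
    then obtain Y t where Y: "tree_transversal_on H Y t" "Y = ?R \<or> n \<le> card Y" by auto
    show ?case
    proof (cases "Y = ?R")
      case True
      then show ?thesis using Y by auto
    next
      case False
      have YR: "Y \<subseteq> ?R" and HY: "H \<in> Y" and tY: "transversal_on H Y t"
        using Y unfolding tree_transversal_on_def transversal_on_def by auto
      have "\<exists>D\<in>Y. D #> s \<notin> Y"
      proof (rule ccontr)
        assume "\<not> (\<exists>D\<in>Y. D #> s \<notin> Y)"
        then have cl: "D #> s \<in> Y" "D #> u \<in> Y" if "D \<in> Y" for D
          using that tY unfolding transversal_on_def by auto
        have "D #> ev w \<in> Y" if "D \<in> Y" for w D
          using that
        proof (induction w arbitrary: D)
          case Nil
          then show ?case using YR rcosets_subset[OF H, of D] by auto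
        next
          case (Cons b w)
          have "D #> (if b then s else u) #> ev w \<in> Y"
            using Cons.IH[of "D #> (if b then s else u)"] cl Cons.prems by auto
          then show ?case using Cons.prems YR rcosets_subset[OF H, of D]
            by (auto simp: coset_mult_assoc)
        qed
        then have "?R \<subseteq> Y" using HY generated unfolding RCOSETS_def by fastforce
        then show False using False YR by auto
      qed
      then obtain D where D: "D \<in> Y" "D #> s \<notin> Y" by auto
      define C where "C = D #> s"
      have DR: "D \<in> ?R" using D YR by auto
      have C: "C \<in> ?R" "C \<notin> Y" using D coset_s_in[OF H DR] by (auto simp: C_def)
      have tD: "t D \<in> carrier G" "H #> t D = D" using tY D unfolding transversal_on_def by auto
      then have "H #> (t D \<otimes> s) = C"
        unfolding C_def using subgroup.subset[OF H] by (metis coset_mult_assoc s_closed)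
      from transversal_on_extend[OF H a tY C _ this] tD obtain t' where
        t': "transversal_on H (insert C (insert (C #> u) (insert (C #> u #> u) Y))) t'"
        "\<And>D. D \<in> Y \<Longrightarrow> t' D = t D" "t' C = t D \<otimes> s" by auto
      let ?Y = "insert C (insert (C #> u) (insert (C #> u #> u) Y))"
      have "tree_transversal_on H ?Y t'"
        unfolding tree_transversal_on_def
      proof (intro conjI allI impI)
        show "t' H = \<one>" using t'(2)[OF HY] Y by (simp add: tree_transversal_on_def)
        fix P assume P: "P H" "tree_closed ?Y t' P"
        have "tree_closed Y t P"
          using P(2) t'(2) unfolding tree_closed_def by auto
        then have PY: "\<forall>C\<in>Y. P C" using Y P(1) unfolding tree_transversal_on_def by auto
        have "D \<in> ?Y" "D #> s \<in> ?Y" "P D" "t' (D #> s) = t' D \<otimes> s"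
          using D(1) PY t'(3) t'(2)[OF D(1)] by (simp_all add: C_def)
        then have "P C" using P(2) unfolding tree_closed_def C_def by blast
        moreover from this have "P (C #> u)" using P(2) unfolding tree_closed_def by auto
        moreover from this have "P (C #> u #> u)" using P(2) unfolding tree_closed_def by auto
        ultimately show "\<forall>C\<in>?Y. P C" using PY by auto
      qed (use t' HY in auto)
      moreover have "Suc n \<le> card ?Y"
      proof -
        have fY: "finite Y" using finite_subset[OF YR fin] .
        then have "Suc (card Y) = card (insert C Y)" using C by simp
        also have "\<dots> \<le> card ?Y" using fY by (intro card_mono) auto
        finally show ?thesis using Y(2) False by simp
      qed
      ultimately show ?thesis by blast
    qed
  qed
  from this[of "Suc (card ?R)"] obtain Y t where
    Y: "tree_transversal_on H Y t" "Y = ?R \<or> Suc (card ?R) \<le> card Y" by blast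
  then have "Y \<subseteq> ?R" unfolding tree_transversal_on_def transversal_on_def by auto
  then have "card Y \<le> card ?R" by (rule card_mono[OF fin])
  then have "Y = ?R" using Y(2) by linarith
  then show ?thesis using Y that by blast
qed

text \<open>The basis is the Schreier basis: for every edge outside the tree, go from the base coset
  to the edge along the tree, cross it and return along the tree. Steps by \<open>u\<close>
  contribute no generators because \<open>t\<close> follows \<open>u\<close> around each orbit.
  Uniqueness of reduced words comes from an action, existence from rewriting paths.\<close>

lemma free_group_if_avoids_torsion:
  assumes H: "subgroup H G" and a: "avoids_torsion H" and fin: "finite (rcosets H)"
  shows "free_group (G\<lparr>carrier := H\<rparr>)"
proof -
  let ?R = "rcosets H" and ?red = "successively (no_cancel :: bool \<times> 'a \<Rightarrow> _)"
  have HG: "H \<subseteq> carrier G" using subgroup.subset[OF H] .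
  have HR: "H \<in> ?R" using subgroup.subgroup_in_rcosets[OF H is_group] .
  obtain t where t: "tree_transversal_on H ?R t" using tree_transversal_exists[OF assms] .
  then have tc [simp]: "t C \<in> carrier G" and tC: "H #> t C = C" and tu: "t (C #> u) = t C \<otimes> u"
    if "C \<in> ?R" for C
    using that unfolding tree_transversal_on_def transversal_on_def by blast+
  have tree: "P C" if "P H" "tree_closed ?R t P" "C \<in> ?R" for P C
    using that t unfolding tree_transversal_on_def by blast+
  have tH: "t H = \<one>" using t unfolding tree_transversal_on_def by blast
  note sR = coset_s_in[OF H] and uR = coset_u_in[OF H] and ss = coset_s_s[OF H]

  define tree_edge where "tree_edge C \<longleftrightarrow> t (C #> s) = t C \<otimes> s" for C
  define loop where "loop C = t C \<otimes> s \<otimes> inv (t (C #> s))" for C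
  \<comment> \<open>The choice depends only on the unordered pair of \<open>C\<close> and
    \<open>C #> s\<close>, so it orients every edge and exactly one of the two cosets is
    positive.\<close>
  define pos where "pos C \<longleftrightarrow> C = (SOME D. D \<in> {C, C #> s})" for C
  define S where "S = {loop C | C. C \<in> ?R \<and> pos C \<and> \<not> tree_edge C}"
  \<comment> \<open>The two directions of an edge receive formally inverse letters over the same
    basis element, in agreement with \<open>loop_s\<close>.\<close>
  define lab where "lab C = (if pos C then (True, loop C) else (False, loop (C #> s)))" for C

  have pos_s: "pos (C #> s) \<longleftrightarrow> \<not> pos C" if "C \<in> ?R" for C
  proof -
    have "(SOME D. D \<in> {C, C #> s}) \<in> {C, C #> s}" by (rule someI[of _ C]) simp
    moreover have "{C #> s, C #> s #> s} = {C, C #> s}" using ss[OF that] by auto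
    moreover have "C #> s \<noteq> C" using coset_s_ne[OF H that a] .
    ultimately show ?thesis unfolding pos_def by auto
  qed
  have loop_closed [simp]: "loop C \<in> carrier G" if "C \<in> ?R" for C
    using that sR[OF that] by (simp add: loop_def)
  have loop_H: "loop C \<in> H" if "C \<in> ?R" for C
  proof -
    have "H #> (t C \<otimes> s) = C #> s" using coset_mult_assoc[OF HG, of "t C" s] that tC[OF that] by simp
    also have "\<dots> = H #> t (C #> s)" using tC[OF sR[OF that]] by simp
    finally show ?thesis unfolding loop_def
      using r_coset_eq_iff[OF H, of "t C \<otimes> s" "t (C #> s)"] that sR[OF that] by simp
  qed
  have cancel: "inv g \<otimes> (g \<otimes> x) = x" "g \<otimes> (inv g \<otimes> x) = x" if "x \<in> carrier G" "g \<in> carrier G" for g x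
    using that by (simp_all add: m_assoc[symmetric])
  have cancel_s: "s \<otimes> (s \<otimes> x) = x" if "x \<in> carrier G" for x
    using that by (simp add: m_assoc[symmetric] s_square)
  have loop_s: "loop (C #> s) = inv (loop C)" if "C \<in> ?R" for C
  proof -
    have "loop C \<otimes> loop (C #> s) = \<one>"
      unfolding loop_def ss[OF that] using that sR[OF that] by (simp add: m_assoc cancel cancel_s)
    then show ?thesis using that sR[OF that] inv_unique' by (metis inv_equality inv_inv loop_closed inv_closed)
  qed
  have loop_tree: "loop C = \<one>" if "C \<in> ?R" "tree_edge C" for C
    using that sR[OF that(1)] unfolding loop_def tree_edge_def by (metis m_closed r_inv s_closed tc)
  have tree_edge_s: "tree_edge (C #> s) \<longleftrightarrow> tree_edge C" if "C \<in> ?R" for C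
  proof -
    have "tree_edge (C #> s)" if "C \<in> ?R" "tree_edge C" for C
      using that unfolding tree_edge_def ss[OF that(1)] by (simp add: m_assoc s_square)
    from this[OF that] this[OF sR[OF that]] show ?thesis using ss[OF that] by auto
  qed
  have S_H: "S \<subseteq> H" unfolding S_def using loop_H by auto
  then have S_G: "S \<subseteq> carrier G" using HG by auto
  have lab_S: "snd (lab C) \<in> S" if "C \<in> ?R" "\<not> tree_edge C" for C
    unfolding lab_def S_def using that pos_s[OF that(1)] sR[OF that(1)] tree_edge_s[OF that(1)] by auto
  have lab_eval: "word_eval G (lab C # w) = loop C \<otimes> word_eval G w" if "C \<in> ?R" for C w
    using loop_s[OF that] loop_closed[OF that] by (auto simp: lab_def)
  have lab_s: "fst (lab (C #> s)) = (\<not> fst (lab C))" "snd (lab (C #> s)) = snd (lab C)"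
    if "C \<in> ?R" for C
    unfolding lab_def using that pos_s[OF that] ss[OF that] by auto

  text \<open>
    The fundamental group acts on the universal cover: crossing an edge outside the tree multiplies
    the second component by the corresponding letter.  As \<open>\<sigma>\<close> and \<open>\<tau>\<close> have orders 2 and 3, this is
    an action of \<open>G\<close>, and it recovers a reduced word from its value.
  \<close>
  define \<sigma> where "\<sigma> = (\<lambda>(C, w). if C \<in> ?R \<and> ?red w
      then (C #> s, if tree_edge C then w else push (lab C) w) else (C, w))"
  define \<tau> where "\<tau> = (\<lambda>(C, w :: (bool \<times> 'a) list). if C \<in> ?R then (C #> u, w) else (C, w))"
  have push_lab: "push (lab (C #> s)) (push (lab C) w) = w" if "C \<in> ?R" "?red w" for C w
  proof -
    have "lab (C #> s) = (\<not> fst (lab C), snd (lab C))"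
      using lab_s[OF that(1)] by (simp add: prod_eq_iff)
    then show ?thesis
      using push_push_inverse[OF that(2), of "\<not> fst (lab C)" "snd (lab C)"] by simp
  qed
  have mod: "modular_action \<sigma> \<tau>"
    unfolding modular_action_def
  proof (intro conjI allI)
    fix x :: "'a set \<times> (bool \<times> 'a) list"
    obtain C w where x: "x = (C, w)" by (cases x)
    show "\<sigma> (\<sigma> x) = x"
      using push_lab[of C w] sR[of C] ss[of C] tree_edge_s[of C] successively_push[of w "lab C"]
      by (auto simp: \<sigma>_def x)
    show "\<tau> (\<tau> (\<tau> x)) = x"
      using uR[of C] uR[of "C #> u"] coset_u_u_u[OF H, of C] by (auto simp: \<tau>_def x)
  qed
  note act_simps = act_mult[OF mod] act_s[OF mod] act_u[OF mod] act_one[OF mod]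

  \<comment> \<open>The representative \<open>t C\<close> spells a path inside the tree, where no
    letter is pushed. The proof is the induction principle of the tree.\<close>
  have act_t: "act \<sigma> \<tau> (t C) (H, w) = (C, w)" if "C \<in> ?R" "?red w" for C w
  proof -
    have "\<forall>w. ?red w \<longrightarrow> act \<sigma> \<tau> (t C) (H, w) = (C, w)"
    proof (rule tree[of "\<lambda>C. \<forall>w. ?red w \<longrightarrow> act \<sigma> \<tau> (t C) (H, w) = (C, w)" C])
      show "tree_closed ?R t (\<lambda>C. \<forall>w. ?red w \<longrightarrow> act \<sigma> \<tau> (t C) (H, w) = (C, w))"
        unfolding tree_closed_def
      proof (intro conjI ballI impI allI)
        fix C w assume C: "C \<in> ?R" and IH: "\<forall>w. ?red w \<longrightarrow> act \<sigma> \<tau> (t C) (H, w) = (C, w)"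
          and w: "?red w"
        show "act \<sigma> \<tau> (t (C #> u)) (H, w) = (C #> u, w)"
          using C IH w by (simp add: tu act_simps) (simp add: \<tau>_def)
        assume "t (C #> s) = t C \<otimes> s"
        then show "act \<sigma> \<tau> (t (C #> s)) (H, w) = (C #> s, w)"
          using C IH w by (simp add: act_simps) (simp add: \<sigma>_def tree_edge_def)
      qed
    qed (use that tH act_one[OF mod] in auto)
    then show ?thesis using that by blast
  qed
  have act_loop: "act \<sigma> \<tau> (loop C) (H, w) = (H, push (lab C) w)"
    if "C \<in> ?R" "\<not> tree_edge C" "?red w" for C w
  proof -
    let ?v = "push (lab C) w"
    have "act \<sigma> \<tau> (loop C) (H, w) = act \<sigma> \<tau> (inv (t (C #> s))) (C #> s, ?v)"
      unfolding loop_def using that sR[OF that(1)]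
      by (simp add: act_simps act_t) (simp add: \<sigma>_def)
    also have "(C #> s, ?v) = act \<sigma> \<tau> (t (C #> s)) (H, ?v)"
      using act_t sR that successively_push by metis
    also have "act \<sigma> \<tau> (inv (t (C #> s))) \<dots> = (H, ?v)"
      using sR[OF that(1)] by (intro act_inv[OF mod]) simp
    finally show ?thesis .
  qed
  have act_letter: "act \<sigma> \<tau> (if b then e else inv e) (H, w) = (H, push (b, e) w)"
    if "e \<in> S" "?red w" for b e w
  proof -
    from that obtain C where C: "C \<in> ?R" "pos C" "\<not> tree_edge C" "e = loop C"
      unfolding S_def by auto
    define D where "D = (if b then C else C #> s)"
    have D: "D \<in> ?R" "\<not> tree_edge D" using C sR tree_edge_s by (auto simp: D_def)
    have "lab D = (b, e)" using C pos_s ss by (auto simp: D_def lab_def)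
    moreover have "loop D = (if b then e else inv e)" using C loop_s by (auto simp: D_def)
    ultimately show ?thesis using act_loop[OF D that(2)] by simp
  qed
  \<comment> \<open>The action is from the right, so the first letter of \<open>w\<close> is pushed
    first and ends up deepest: the word appears reversed. Reducedness of the result rules out any
    cancellation on the way.\<close>
  have act_word: "act \<sigma> \<tau> (word_eval G w) (H, v) = (H, rev w @ v)"
    if "snd ` set w \<subseteq> S" "?red (rev w @ v)" for w v
    using that
  proof (induction w arbitrary: v)
    case Nil
    then show ?case using act_one[OF mod] by simp
  next
    case (Cons l w)
    obtain b e where l: "l = (b, e)" by (cases l)
    have e: "e \<in> S" "e \<in> carrier G" using Cons.prems S_G by (auto simp: l)
    have red: "?red (l # v)" using Cons.prems by (simp add: successively_append_iff)
    have "push l v = l # v" using red by (cases v) (auto simp: push_def)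
    moreover have "?red v" using red by (simp add: successively_Cons) auto
    ultimately have "act \<sigma> \<tau> (if b then e else inv e) (H, v) = (H, l # v)"
      using act_letter[OF e(1), of v b] by (simp add: l)
    moreover have "word_eval G w \<in> carrier G"
      using Cons.prems S_G by (intro word_eval_closed) auto
    ultimately have "act \<sigma> \<tau> (word_eval G (l # w)) (H, v) = act \<sigma> \<tau> (word_eval G w) (H, l # v)"
      using e by (cases b) (simp_all add: l act_simps)
    then show ?case using Cons by simp
  qed
  have inj: "inj_on (word_eval G) (reduced_words S)"
  proof (rule inj_onI)
    fix v w assume vw: "v \<in> reduced_words S" "w \<in> reduced_words S" "word_eval G v = word_eval G w"
    have "act \<sigma> \<tau> (word_eval G x) (H, []) = (H, rev x)" if "x \<in> reduced_words S" for x
    proof -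
      have *: "(\<lambda>x y :: bool \<times> 'a. no_cancel y x) = no_cancel"
        by (intro ext) (rule no_cancel_commute)
      have "?red (rev x @ [])"
        using that unfolding reduced_words_iff append_Nil2 successively_rev * by blast
      then show ?thesis using act_word[of x "[]"] that unfolding reduced_words_iff append_Nil2 by blast
    qed
    then have "(H, rev v) = (H, rev w)" using vw by metis
    then show "v = w" by simp
  qed

  \<comment> \<open>\<open>K\<close> collects the values of reduced words; it remains to prove that
    it is all of \<open>H\<close>. Closure under left multiplication by letters is enough, and
    \<open>push\<close> restores reducedness.\<close>
  define K where "K = word_eval G ` reduced_words S"
  have K_letter: "word_eval G (l # w) \<in> K" if w: "w \<in> reduced_words S" and l: "snd l \<in> S" for l w
  proof -
    obtain b e where be: "l = (b, e)" by (cases l)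
    have wG: "word_eval G v \<in> carrier G" if "v \<in> reduced_words S" for v
      using that S_G by (intro word_eval_closed) (auto simp: reduced_words_iff)
    have eG: "e \<in> carrier G" using l S_G by (auto simp: be)
    have red: "push l w \<in> reduced_words S"
      using w l successively_push[of w l] unfolding reduced_words_iff
      by (cases w) (auto simp: push_def)
    have "word_eval G (l # w) = word_eval G (push l w)"
    proof (cases "w = [] \<or> no_cancel l (hd w)")
      case False
      then obtain w' where w': "w = (\<not> b, e) # w'"
        by (cases w) (auto simp: no_cancel_def be)
      then have "w' \<in> reduced_words S" using w by (auto simp: reduced_words_iff successively_Cons)
      then show ?thesis using wG eG w'
        by (cases b) (auto simp: push_def be no_cancel_def cancel)
    qed (auto simp: push_def)
    then show ?thesis using red unfolding K_def by auto
  qed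
  have K_one: "\<one> \<in> K" unfolding K_def
    by (rule image_eqI[of _ _ "[]"]) (simp_all add: reduced_words_iff)
  have K_loop: "loop C \<otimes> k \<in> K" if "C \<in> ?R" "k \<in> K" for C k
  proof -
    from that(2) obtain w where w: "w \<in> reduced_words S" "k = word_eval G w" unfolding K_def by auto
    have kG: "k \<in> carrier G" unfolding w(2)
      using w(1) S_G by (intro word_eval_closed) (auto simp: reduced_words_iff)
    show ?thesis
    proof (cases "tree_edge C")
      case True
      then show ?thesis using loop_tree[OF that(1)] kG that(2) by simp
    next
      case False
      then show ?thesis using K_letter[OF w(1) lab_S[OF that(1) False]] lab_eval[OF that(1)] w(2) by simp
    qed
  qed
  \<comment> \<open>Schreier rewriting: the path spelled by \<open>w\<close> from \<open>C\<close>,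
    closed up through tree representatives, is a product of loops, one for each letter
    \<open>s\<close>. For \<open>C = H\<close> and a word of value \<open>h\<close> in
    \<open>H\<close> the two representatives are trivial and the expression is \<open>h\<close>
    itself.\<close>
  have K_path: "t C \<otimes> ev w \<otimes> inv (t (C #> ev w)) \<in> K" if "C \<in> ?R" for C w
    using that
  proof (induction w arbitrary: C)
    case Nil
    then show ?case using K_one rcosets_subset[OF H Nil] by simp
  next
    case (Cons b w)
    have CG: "C \<subseteq> carrier G" using rcosets_subset[OF H Cons.prems] .
    have eq: "C #> ev (b # w) = C #> (if b then s else u) #> ev w"
      using CG by (simp add: coset_mult_assoc)
    define D where "D = C #> (if b then s else u)"
    have D: "D \<in> ?R" using sR uR Cons.prems by (auto simp: D_def)
    have E: "D #> ev w \<in> ?R" using rcosets_r_coset[OF H D] by simp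
    have IH: "t D \<otimes> ev w \<otimes> inv (t (D #> ev w)) \<in> K" using Cons.IH[OF D] .
    show ?case
    proof (cases b)
      case True
      then have D': "D = C #> s" by (simp add: D_def)
      have "t C \<otimes> ev (b # w) \<otimes> inv (t (D #> ev w)) = loop C \<otimes> (t D \<otimes> ev w \<otimes> inv (t (D #> ev w)))"
        unfolding loop_def D'[symmetric] using True Cons.prems D E
        by (simp add: m_assoc cancel)
      then show ?thesis unfolding eq D_def[symmetric] using K_loop[OF Cons.prems IH] by simp
    next
      case False
      then have "t C \<otimes> ev (b # w) \<otimes> inv (t (D #> ev w)) = t D \<otimes> ev w \<otimes> inv (t (D #> ev w))"
        using Cons.prems D E tu[OF Cons.prems] by (simp add: m_assoc D_def)
      then show ?thesis unfolding eq D_def[symmetric] using IH by simp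
    qed
  qed
  have "K = H"
  proof
    have "word_eval G w \<in> H" if "snd ` set w \<subseteq> S" for w
      using that S_H
      by (induction w) (auto intro!: subgroup.m_closed[OF H] subgroup.m_inv_closed[OF H] subgroup.one_closed[OF H])
    then show "K \<subseteq> H" unfolding K_def by (auto simp: reduced_words_iff)
    show "H \<subseteq> K"
    proof
      fix h assume h: "h \<in> H"
      then have hG: "h \<in> carrier G" using HG by auto
      then obtain w where w: "ev w = h" using generated by auto
      have "H #> h = H" using coset_join2[OF hG H h] .
      then show "h \<in> K" using K_path[OF HR, of w] tH hG w by simp
    qed
  qed
  then have bij: "bij_betw (word_eval G) (reduced_words S) H"
    using inj unfolding K_def bij_betw_def by auto
  have eval_H: "word_eval (G\<lparr>carrier := H\<rparr>) w = word_eval G w" if "w \<in> reduced_words S" for w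
  proof -
    have "snd ` set w \<subseteq> H" using that S_H by (auto simp: reduced_words_iff)
    then show ?thesis by (induction w) (auto simp: m_inv_consistent[OF H])
  qed
  have "bij_betw (word_eval (G\<lparr>carrier := H\<rparr>)) (reduced_words S) H"
    using bij bij_betw_cong[of "reduced_words S" "word_eval (G\<lparr>carrier := H\<rparr>)" "word_eval G"] eval_H by auto
  then have "free_on (G\<lparr>carrier := H\<rparr>) S"
    using S_H unfolding free_on_def by simp
  then show ?thesis
    unfolding free_group_def using subgroup.subgroup_is_group[OF H is_group] by auto
qed

lemma free_subgroups_of_index_eq:
  "free_subgroups_of_index G n =
    {H. subgroup H G \<and> finite (rcosets H) \<and> card (rcosets H) = n \<and> avoids_torsion H}"
  unfolding free_subgroups_of_index_def
  using free_avoids_torsion free_group_if_avoids_torsion by auto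

end

section \<open>The modular group\<close>

definition mat2 :: "int \<Rightarrow> int \<Rightarrow> int \<Rightarrow> int \<Rightarrow> int^2^2" where
  "mat2 a b c d = vector [vector [a, b], vector [c, d]]"

lemma mat2_nth [simp]:
  "mat2 a b c d $ 1 $ 1 = a" "mat2 a b c d $ 1 $ 2 = b"
  "mat2 a b c d $ 2 $ 1 = c" "mat2 a b c d $ 2 $ 2 = d"
  by (simp_all add: mat2_def)

lemma mat2_eq_iff [simp]: "mat2 a b c d = mat2 a' b' c' d' \<longleftrightarrow> a = a' \<and> b = b' \<and> c = c' \<and> d = d'"
  by (auto simp: vec_eq_iff forall_2)

lemma mat2_cases [cases type]: obtains a b c d where "A = mat2 a b c d"
proof
  show "A = mat2 (A $ 1 $ 1) (A $ 1 $ 2) (A $ 2 $ 1) (A $ 2 $ 2)"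
    by (simp add: vec_eq_iff forall_2)
qed

lemma mat2_mult [simp]: "mat2 a b c d ** mat2 a' b' c' d' =
    mat2 (a * a' + b * c') (a * b' + b * d') (c * a' + d * c') (c * b' + d * d')"
  by (simp add: vec_eq_iff forall_2 matrix_matrix_mult_def sum_2)

lemma mat2_uminus [simp]: "- mat2 a b c d = mat2 (- a) (- b) (- c) (- d)"
  by (simp add: vec_eq_iff forall_2)

lemma mat2_one: "mat 1 = mat2 1 0 0 1"
  by (simp add: vec_eq_iff forall_2 mat_def)

lemma mat2_det [simp]: "det (mat2 a b c d) = a * d - b * c"
  by (simp add: det_2)

definition mS :: "int^2^2" where "mS = mat2 0 (- 1) 1 0"
definition mU :: "int^2^2" where "mU = mat2 0 (- 1) 1 1"

definition mev :: "bool list \<Rightarrow> int^2^2" where "mev = gen_eval SL2Z mS mU"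

lemma mev_simps [simp]:
  "mev [] = mat 1"
  "mev (b # w) = (if b then mS else mU) ** mev w"
  by (simp_all add: mev_def SL2Z_def)

lemma mev_append: "mev (v @ w) = mev v ** mev w"
  by (induction v) (auto simp: matrix_mul_assoc)

definition unit2 :: "(int^2^2) set" where "unit2 = {mat 1, - mat 1}"

lemma alternating_Cons:
  "alternating (b # w) \<longleftrightarrow> alternating w \<and>
     \<not> (b \<and> w \<noteq> [] \<and> hd w) \<and>
     \<not> (\<not> b \<and> w \<noteq> [] \<and> \<not> hd w \<and> tl w \<noteq> [] \<and> \<not> hd (tl w))"
proof -
  have "(\<exists>p q. b # w = p @ v @ q) \<longleftrightarrow> (\<exists>p q. w = p @ v @ q) \<or> (\<exists>q. b # w = v @ q)" for v
    by (auto simp: Cons_eq_append_conv[of b w])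
  from this[of "[True, True]"] this[of "[False, False, False]"] show ?thesis
    unfolding alternating_def by (cases w; cases "tl w") auto
qed

lemma alternating_appendD: "alternating (v @ w) \<Longrightarrow> alternating v"
  unfolding alternating_def by (metis append_assoc)

text \<open>
  Ping-pong for the vector \<open>(1, 1)\<close>: a reduced word not ending in \<open>S\<close> moves it to a vector whose
  coordinates have equal signs if it starts with \<open>S\<close> and opposite signs if it starts with \<open>U\<close>.
\<close>

definition row_sums :: "int^2^2 \<Rightarrow> int \<times> int" where
  "row_sums A = (A $ 1 $ 1 + A $ 1 $ 2, A $ 2 $ 1 + A $ 2 $ 2)"

lemma row_sums_mS: "row_sums (mS ** A) = (- snd (row_sums A), fst (row_sums A))"
  by (cases A) (simp add: row_sums_def mS_def)

lemma row_sums_mU: "row_sums (mU ** A) = (- snd (row_sums A), fst (row_sums A) + snd (row_sums A))"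
  by (cases A) (simp add: row_sums_def mU_def)

text \<open>Removing a leading \<open>S U\<close> or \<open>S U U\<close> leaves a word of the same
  kind. Equal signs alone would not exclude the values (1, 1) and (-1, -1), whose coordinate sums
  have absolute value 2; hence the strict growth of the sum for nonempty words.\<close>

lemma row_sums_pos:
  assumes "alternating w" "w = [] \<or> hd w" "w = [] \<or> \<not> last w" "row_sums (mev w) = (x, y)"
  shows "x * y > 0 \<and> \<bar>x + y\<bar> \<ge> 2 \<and> (w \<noteq> [] \<longrightarrow> \<bar>x + y\<bar> > 2)"
  using assms
proof (induction "length w" arbitrary: w x y rule: less_induct)
  case less
  have gt: "(- (x' + y')) * (- y') > 0 \<and> \<bar>- (x' + y') + - y'\<bar> > 2"
    "(- x') * (- (x' + y')) > 0 \<and> \<bar>- x' + - (x' + y')\<bar> > 2"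
    if "x' * y' > 0" "\<bar>x' + y'\<bar> \<ge> 2" for x' y' :: int
    using that by (auto simp: zero_less_mult_iff mult_less_0_iff)
  show ?case
  proof (cases w)
    case Nil
    then show ?thesis using less.prems by (auto simp: row_sums_def mat2_one)
  next
    case (Cons b v)
    then have b: "b" and v: "v \<noteq> []" "\<not> hd v" using less.prems by (auto simp: alternating_Cons)
    then obtain v1 where v1: "v = False # v1" by (cases v) auto
    show ?thesis
    proof (cases "v1 = [] \<or> hd v1")
      case True
      obtain x' y' where xy: "row_sums (mev v1) = (x', y')" by (cases "row_sums (mev v1)")
      have "x' * y' > 0 \<and> \<bar>x' + y'\<bar> \<ge> 2 \<and> (v1 \<noteq> [] \<longrightarrow> \<bar>x' + y'\<bar> > 2)"
        using less.prems Cons v1 True xy by (intro less.hyps) (auto simp: alternating_Cons)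
      moreover have "x = - (x' + y')" "y = - y'"
        using less.prems(4) b xy by (auto simp: Cons v1 row_sums_mS row_sums_mU)
      ultimately show ?thesis using gt(1)[of x' y'] by auto
    next
      case False
      then obtain v2 where v2: "v1 = False # v2" by (cases v1) auto
      have v2': "v2 = [] \<or> hd v2" "alternating v2" using less.prems(1) by (auto simp: Cons v1 v2 alternating_Cons)
      obtain x' y' where xy: "row_sums (mev v2) = (x', y')" by (cases "row_sums (mev v2)")
      have "x' * y' > 0 \<and> \<bar>x' + y'\<bar> \<ge> 2 \<and> (v2 \<noteq> [] \<longrightarrow> \<bar>x' + y'\<bar> > 2)"
        using less.prems(3) Cons v1 v2 v2' xy by (intro less.hyps) (auto split: if_splits)
      moreover have "x = - x'" "y = - (x' + y')"
        using less.prems(4) b xy by (auto simp: Cons v1 v2 row_sums_mS row_sums_mU)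
      ultimately show ?thesis using gt(2)[of x' y'] by auto
    qed
  qed
qed

lemma row_sums_neg:
  assumes "alternating w" "w \<noteq> []" "\<not> hd w" "\<not> last w" "row_sums (mev w) = (x, y)"
  shows "x * y < 0"
proof -
  obtain v where v: "w = False # v" using assms(2,3) by (cases w) auto
  define v' where "v' = (if v = [] \<or> hd v then v else tl v)"
  obtain x' y' where xy: "row_sums (mev v') = (x', y')" by (cases "row_sums (mev v')")
  have "x' * y' > 0 \<and> \<bar>x' + y'\<bar> \<ge> 2 \<and> (v' \<noteq> [] \<longrightarrow> \<bar>x' + y'\<bar> > 2)"
    using assms(1,4) xy
    by (intro row_sums_pos) (cases v; auto simp: v v'_def alternating_Cons split: if_splits)+
  moreover have "(x, y) = (- y', x' + y') \<or> (x, y) = (- (x' + y'), x')"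
  proof -
    have "mev w = mU ** mev v' \<or> mev w = mU ** (mU ** mev v')"
      by (cases v) (auto simp: v v'_def)
    then show ?thesis using assms(5) xy row_sums_mU[of "mev v'"] row_sums_mU[of "mU ** mev v'"] by auto
  qed
  ultimately show ?thesis by (auto simp: zero_less_mult_iff mult_less_0_iff)
qed

text \<open>The ping-pong argument covers words that do not end in \<open>S\<close>. A final
  \<open>S\<close> is removed by conjugation, which preserves plus or minus the identity: it is
  moved to the front if the word starts with \<open>U\<close>, and if the word is
  \<open>S w'' S\<close> both ends are dropped.\<close>

lemma mev_faithful:
  assumes "alternating w" "mev w \<in> unit2"
  shows "w = []"
proof (rule ccontr)
  assume "w \<noteq> []"
  have *: "mev v \<notin> unit2" if v: "alternating v" "v \<noteq> []" "\<not> last v" for v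
  proof
    assume "mev v \<in> unit2"
    then have rs: "row_sums (mev v) = (1, 1) \<or> row_sums (mev v) = (- 1, - 1)"
      by (auto simp: unit2_def row_sums_def mat2_one)
    show False
    proof (cases "hd v")
      case True
      then show False using row_sums_pos[OF v(1)] rs v by fastforce
    next
      case False
      then show False using row_sums_neg[OF v(1)] rs v by fastforce
    qed
  qed
  show False
  proof (cases "last w")
    case False
    then show False using * assms \<open>w \<noteq> []\<close> by auto
  next
    case True
    then obtain w' where w': "w = w' @ [True]" using \<open>w \<noteq> []\<close> by (metis append_butlast_last_id)
    have alt: "alternating w'" using assms(1) alternating_appendD w' by blast
    have last: "\<not> last w'" if "w' \<noteq> []"
    proof
      assume "last w'"
      then have "w' = butlast w' @ [True]" using append_butlast_last_id[OF that] by simp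
      then have "w = (butlast w' @ [True]) @ [True]" using w' by argo
      then have "w = butlast w' @ [True, True] @ []" by simp
      then show False using assms(1) unfolding alternating_def by blast
    qed
    show False
    proof (cases "w' = [] \<or> \<not> hd w'")
      case T: True
      have "alternating (True # w')" using alt T by (auto simp: alternating_Cons)
      have "mev (True # w') \<in> unit2"
        using assms(2) unfolding w' mev_append
        by (cases "mev w'") (auto simp: unit2_def mat2_one mS_def)
      show False
      proof (cases "w' = []")
        case True
        then show False using assms(2) by (auto simp: w' unit2_def mat2_one mS_def)
      next
        case False
        then show ?thesis
          using *[of "True # w'"] last \<open>alternating (True # w')\<close> \<open>mev (True # w') \<in> unit2\<close> by simp
      qed
    next
      case F: False
      then obtain w'' where w'': "w' = True # w''" by (cases w') auto
      have "w'' \<noteq> []" using last w'' by auto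
      moreover have "alternating w''" using alt w'' by (auto simp: alternating_Cons)
      moreover have "mev w'' \<in> unit2"
        using assms(2) unfolding w' w'' append_Cons mev_simps mev_append
        by (cases "mev w''") (auto simp: unit2_def mat2_one mS_def)
      ultimately show False using * last F w'' by auto
    qed
  qed
qed

section \<open>Generation of the modular group\<close>

definition signed_words :: "(int^2^2) set" where
  "signed_words = {A. \<exists>w. A = mev w \<or> A = - mev w}"

lemma signed_words_step:
  assumes "A \<in> signed_words"
  shows "mS ** A \<in> signed_words" "mU ** A \<in> signed_words" "- A \<in> signed_words"
proof -
  obtain w where w: "A = mev w \<or> A = - mev w" using assms by (auto simp: signed_words_def)
  have n: "B ** (- C) = - (B ** C)" for B C :: "int^2^2"
    by (cases B; cases C) simp
  have "mS ** A = mev (True # w) \<or> mS ** A = - mev (True # w)" using w by (auto simp: n)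
  then show "mS ** A \<in> signed_words" unfolding signed_words_def by blast
  have "mU ** A = mev (False # w) \<or> mU ** A = - mev (False # w)" using w by (auto simp: n)
  then show "mU ** A \<in> signed_words" unfolding signed_words_def by blast
  have "- A = mev w \<or> - A = - mev w" using w by auto
  then show "- A \<in> signed_words" unfolding signed_words_def by blast
qed

text \<open>\<open>mS ** mU\<close> is minus the unit translation, and \<open>mU ** mU ** mS\<close>
  is minus its inverse, so each unit step in \<open>k\<close> costs only generators and a
  sign.\<close>

lemma signed_words_translate:
  assumes "A \<in> signed_words"
  shows "mat2 1 k 0 1 ** A \<in> signed_words"
proof (induction k rule: int_induct[of _ 0])
  case base
  then show ?case using assms by (simp add: mat2_one[symmetric])
next
  case (step1 i)
  have "mat2 1 (i + 1) 0 1 ** A = - (mS ** (mU ** (mat2 1 i 0 1 ** A)))"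
    by (cases A) (simp add: mS_def mU_def algebra_simps)
  then show ?case using signed_words_step step1 by metis
next
  case (step2 i)
  have "mat2 1 (i - 1) 0 1 ** A = mU ** (mU ** (mS ** (mat2 1 i 0 1 ** A))) \<or>
     mat2 1 (i - 1) 0 1 ** A = - (mU ** (mU ** (mS ** (mat2 1 i 0 1 ** A))))"
    by (cases A) (simp add: mS_def mU_def algebra_simps)
  then show ?case using signed_words_step step2 by metis
qed

text \<open>The Euclidean algorithm on the first column: a translation replaces \<open>a\<close> by
  \<open>a mod c\<close>, and \<open>mS\<close> moves this remainder into the lower left corner.
  When that corner is 0, the matrix is a translation up to sign.\<close>

lemma signed_words_all:
  assumes "det A = 1"
  shows "A \<in> signed_words"
  using assms
proof (induction "nat \<bar>A $ 2 $ 1\<bar>" arbitrary: A rule: less_induct)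
  case less
  obtain a b c d where A: "A = mat2 a b c d" by (cases A)
  have det: "a * d - b * c = 1" using less.prems by (simp add: A)
  have one: "mat 1 \<in> signed_words" unfolding signed_words_def by (auto intro: exI[of _ "[]"])
  show ?case
  proof (cases "c = 0")
    case True
    then have "a * d = 1" using det by simp
    then have "a = 1 \<and> d = 1 \<or> a = - 1 \<and> d = - 1" using zmult_eq_1_iff[of a d] by auto
    then have "A = mat2 1 b 0 1 ** mat 1 \<or> A = - (mat2 1 (- b) 0 1 ** mat 1)"
      using True by (auto simp: A mat2_one)
    then show ?thesis using signed_words_translate[OF one] signed_words_step by metis
  next
    case False
    define q where "q = a div c"
    define B where "B = mS ** (mat2 1 (- q) 0 1 ** A)"
    have B: "B = mat2 (- c) (- d) (a - q * c) (b - q * d)" by (simp add: B_def A mS_def)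
    have "a - q * c = a mod c" unfolding q_def by (simp add: minus_div_mult_eq_mod)
    then have "nat \<bar>B $ 2 $ 1\<bar> < nat \<bar>A $ 2 $ 1\<bar>"
      using False abs_mod_less[of c a] by (simp add: B A)
    moreover have "det B = 1" using det by (simp add: B algebra_simps)
    ultimately have "B \<in> signed_words" by (rule less.hyps)
    then have "mat2 1 q 0 1 ** (- (mS ** B)) \<in> signed_words"
      by (intro signed_words_translate signed_words_step)
    moreover have "mat2 1 q 0 1 ** (- (mS ** B)) = A" by (simp add: B A mS_def)
    ultimately show ?thesis by simp
  qed
qed

lemma SL2Z_simps [simp]:
  "carrier SL2Z = {A. det A = 1}" "x \<otimes>\<^bsub>SL2Z\<^esub> y = x ** y" "\<one>\<^bsub>SL2Z\<^esub> = mat 1"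
  by (simp_all add: SL2Z_def)

lemma group_SL2Z: "group SL2Z"
proof (rule groupI)
  fix A assume "A \<in> carrier SL2Z"
  moreover obtain a b c d where A: "A = mat2 a b c d" by (cases A)
  ultimately show "\<exists>B\<in>carrier SL2Z. B \<otimes>\<^bsub>SL2Z\<^esub> A = \<one>\<^bsub>SL2Z\<^esub>"
    by (intro bexI[of _ "mat2 d (- b) (- c) a"]) (simp_all add: mat2_one algebra_simps)
qed (auto simp: det_mul matrix_mul_assoc)

lemma unit2_normal: "unit2 \<lhd> SL2Z"
proof -
  interpret group SL2Z by (rule group_SL2Z)
  have c: "A ** - mat 1 = - A" "- mat 1 ** A = - A" for A :: "int^2^2"
    by (cases A; simp add: mat2_one)+
  have d: "det (- A) = det A" for A :: "int^2^2"
    by (cases A) simp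
  show ?thesis
  proof (rule normalI)
    show "subgroup unit2 SL2Z"
    proof (rule subgroupI)
      fix A assume A: "A \<in> unit2"
      have "inv\<^bsub>SL2Z\<^esub> A = A"
        using A by (intro inv_equality) (auto simp: unit2_def c d)
      then show "inv\<^bsub>SL2Z\<^esub> A \<in> unit2" using A by simp
    qed (auto simp: unit2_def c d)
    show "\<forall>x\<in>carrier SL2Z. unit2 #>\<^bsub>SL2Z\<^esub> x = x <#\<^bsub>SL2Z\<^esub> unit2"
      by (auto simp: r_coset_def l_coset_def unit2_def c)
  qed
qed

definition proj :: "int^2^2 \<Rightarrow> (int^2^2) set" where
  "proj A = unit2 #>\<^bsub>SL2Z\<^esub> A"

lemma PSL2Z_eq: "PSL2Z = SL2Z Mod unit2"
  by (simp add: PSL2Z_def unit2_def)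

lemma group_PSL2Z: "group PSL2Z"
  unfolding PSL2Z_eq by (rule normal.factorgroup_is_group[OF unit2_normal])

lemma proj_mult:
  assumes "det A = 1" "det B = 1"
  shows "proj A \<otimes>\<^bsub>PSL2Z\<^esub> proj B = proj (A ** B)"
  using hom_mult[OF normal.r_coset_hom_Mod[OF unit2_normal], of A B] assms
  by (simp add: proj_def PSL2Z_eq)

lemma proj_uminus: "proj (- A) = proj A"
proof -
  have "- mat 1 ** - A = A" "- mat 1 ** A = - A"
    by (cases A; simp add: mat2_one)+
  then show ?thesis by (auto simp: proj_def r_coset_def unit2_def)
qed

lemma proj_one: "proj (mat 1) = \<one>\<^bsub>PSL2Z\<^esub>"
  by (auto simp: proj_def PSL2Z_eq r_coset_def)

lemma proj_eq_one_iff: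
  assumes "det A = 1"
  shows "proj A = \<one>\<^bsub>PSL2Z\<^esub> \<longleftrightarrow> A \<in> unit2"
proof
  assume "proj A = \<one>\<^bsub>PSL2Z\<^esub>"
  then have eq: "(\<Union>x\<in>unit2. {x ** A}) = unit2" by (simp add: proj_def PSL2Z_eq r_coset_def)
  have "mat 1 ** A \<in> (\<Union>x\<in>unit2. {x ** A})" unfolding unit2_def by blast
  then show "A \<in> unit2" unfolding eq by simp
next
  assume "A \<in> unit2"
  then show "proj A = \<one>\<^bsub>PSL2Z\<^esub>" using proj_one proj_uminus by (auto simp: unit2_def)
qed

lemma det_mev: "det (mev w) = 1"
  by (induction w) (auto simp: mS_def mU_def det_mul)

lemma gen_eval_PSL2Z: "gen_eval PSL2Z (proj mS) (proj mU) w = proj (mev w)"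
  by (induction w) (auto simp: proj_one proj_mult det_mev mS_def mU_def)

lemma modular_generators_PSL2Z: "modular_generators PSL2Z (proj mS) (proj mU)"
proof -
  interpret group PSL2Z by (rule group_PSL2Z)
  have car: "carrier PSL2Z = proj ` {A. det A = 1}"
    by (simp add: PSL2Z_eq carrier_FactGroup proj_def[abs_def])
  have d: "det mS = 1" "det mU = 1" by (simp_all add: mS_def mU_def)
  show ?thesis
  proof unfold_locales
    show "proj mS \<in> carrier PSL2Z" "proj mU \<in> carrier PSL2Z" using d by (auto simp: car)
    have "mS ** mS = - mat 1" "mU ** mU ** mU = - mat 1"
      by (simp_all add: mS_def mU_def mat2_one)
    then show "proj mS \<otimes>\<^bsub>PSL2Z\<^esub> proj mS = \<one>\<^bsub>PSL2Z\<^esub>"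
      "proj mU \<otimes>\<^bsub>PSL2Z\<^esub> proj mU \<otimes>\<^bsub>PSL2Z\<^esub> proj mU = \<one>\<^bsub>PSL2Z\<^esub>"
      using d by (simp_all add: proj_mult det_mul proj_uminus proj_one)
  next
    fix g assume "g \<in> carrier PSL2Z"
    then obtain A where A: "det A = 1" "g = proj A" by (auto simp: car)
    then obtain w where "A = mev w \<or> A = - mev w"
      using signed_words_all by (auto simp: signed_words_def)
    then show "\<exists>w. gen_eval PSL2Z (proj mS) (proj mU) w = g"
      using A(2) by (auto simp: gen_eval_PSL2Z proj_uminus)
  next
    fix w assume "alternating w" "gen_eval PSL2Z (proj mS) (proj mU) w = \<one>\<^bsub>PSL2Z\<^esub>"
    then show "w = []"
      using mev_faithful proj_eq_one_iff det_mev by (simp add: gen_eval_PSL2Z)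
  qed
qed

section \<open>Counting fixed-point free permutations\<close>

text \<open>
  The second condition says both that \<open>f\<close> is the identity outside \<open>X\<close> and that it has no fixed
  point in \<open>X\<close>.  For prime \<open>n\<close> all cycles on \<open>X\<close> then have length \<open>n\<close>.
\<close>

definition free_perms :: "nat \<Rightarrow> 'x set \<Rightarrow> ('x \<Rightarrow> 'x) set" where
  "free_perms n X = {f. (\<forall>x. (f ^^ n) x = x) \<and> (\<forall>x. f x = x \<longleftrightarrow> x \<notin> X)}"

lemma free_perms_inj:
  assumes "f \<in> free_perms n X" "n > 0"
  shows "inj f"
proof (rule injI)
  fix x y assume "f x = f y"
  then have "(f ^^ n) x = (f ^^ n) y"
    using assms(2) by (cases n) (simp_all add: funpow_swap1)
  then show "x = y" using assms(1) by (simp add: free_perms_def)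
qed

lemma free_perms_in:
  assumes "f \<in> free_perms n X" "n > 0" "x \<in> X"
  shows "f x \<in> X"
  using assms free_perms_inj[OF assms(1,2)] unfolding free_perms_def
  by (auto dest: injD)

lemma finite_free_perms:
  assumes "finite X" "n > 0"
  shows "finite (free_perms n X)"
proof (rule finite_subset)
  show "free_perms n X \<subseteq> {f. f permutes X}"
  proof
    fix f assume f: "f \<in> free_perms n X"
    have "inj_on f X" using free_perms_inj[OF f assms(2)] by (rule inj_on_subset) simp
    then have "bij_betw f X X"
      using free_perms_in[OF f assms(2)] by (intro bij_betw_imageI endo_inj_surj assms) auto
    then show "f \<in> {f. f permutes X}"
      using f by (auto intro!: bij_imp_permutes simp: free_perms_def)
  qed
qed (rule finite_permutations[OF assms(1)])

lemma free_perms_empty: "free_perms n {} = {id}"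
proof -
  have "(id ^^ n) x = x" for x :: 'a by (induction n) auto
  then show ?thesis by (auto simp: free_perms_def)
qed

lemma funpow_in: "(\<And>x. x \<in> Y \<Longrightarrow> g x \<in> Y) \<Longrightarrow> x \<in> Y \<Longrightarrow> (g ^^ n) x \<in> Y"
  by (induction n) auto

lemma funpow_glue:
  assumes "\<And>x. x \<in> Y \<Longrightarrow> g x \<in> Y" "\<And>x. x \<notin> Y \<Longrightarrow> h x \<notin> Y"
  shows "((\<lambda>x. if x \<in> Y then g x else h x) ^^ n) x = (if x \<in> Y then (g ^^ n) x else (h ^^ n) x)"
proof -
  have "(g ^^ n) x \<in> Y" if "x \<in> Y" for n using that by (intro funpow_in[of Y g] assms(1))
  moreover have "(h ^^ n) x \<in> - Y" if "x \<notin> Y" for n using funpow_in[of "- Y" h] assms(2) that by auto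
  ultimately show ?thesis by (induction n) auto
qed

text \<open>Since \<open>f ^^ n\<close> is the identity, a point outside \<open>Y\<close> that
  \<open>f\<close> sends into \<open>Y\<close> would return to itself while staying in
  \<open>Y\<close>. So \<open>f\<close> preserves the complement of \<open>Y\<close> too, and
  forgetting its prescribed action on \<open>Y\<close> loses nothing.\<close>

lemma card_free_perms_fixed_part:
  assumes g: "g \<in> free_perms n Y" and Y: "Y \<subseteq> X" and n: "n > 0"
  shows "card {f \<in> free_perms n X. \<forall>y\<in>Y. f y = g y} = card (free_perms n (X - Y))"
proof (rule bij_betw_same_card)
  have gY: "g x \<in> Y" if "x \<in> Y" for x using free_perms_in[OF g n that] .
  show "bij_betw (\<lambda>f x. if x \<in> Y then x else f x)
      {f \<in> free_perms n X. \<forall>y\<in>Y. f y = g y} (free_perms n (X - Y))"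
  proof (rule bij_betw_byWitness[where f' = "\<lambda>h x. if x \<in> Y then g x else h x"])
    show "\<forall>h\<in>free_perms n (X - Y). (\<lambda>x. if x \<in> Y then x else if x \<in> Y then g x else h x) = h"
      by (auto simp: free_perms_def fun_eq_iff) metis
    show "(\<lambda>f x. if x \<in> Y then x else f x) ` {f \<in> free_perms n X. \<forall>y\<in>Y. f y = g y} \<subseteq> free_perms n (X - Y)"
    proof clarify
      fix f assume f: "f \<in> free_perms n X" "\<forall>y\<in>Y. f y = g y"
      have fY: "f x \<notin> Y" if "x \<notin> Y" for x
      proof
        assume "f x \<in> Y"
        then have "(f ^^ (n - 1)) (f x) \<in> Y" using f(2) gY by (intro funpow_in[of Y f]) auto
        then have "(f ^^ n) x \<in> Y" using n by (cases n) (simp_all add: funpow_swap1)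
        then show False using f(1) that by (simp add: free_perms_def)
      qed
      have "((\<lambda>x. x) ^^ n) x = x" for x :: 'a by (induction n) auto
      then show "(\<lambda>x. if x \<in> Y then x else f x) \<in> free_perms n (X - Y)"
        using f(1) Y fY unfolding free_perms_def by (auto simp: funpow_glue)
    qed
    show "(\<lambda>h x. if x \<in> Y then g x else h x) ` free_perms n (X - Y) \<subseteq> {f \<in> free_perms n X. \<forall>y\<in>Y. f y = g y}"
    proof clarify
      fix h assume h: "h \<in> free_perms n (X - Y)"
      have "h x \<notin> Y" if "x \<notin> Y" for x
      proof (cases "x \<in> X")
        case True
        then show ?thesis using free_perms_in[OF h n, of x] that by auto
      next
        case False
        then have "h x = x" using h by (simp add: free_perms_def)
        then show ?thesis using that by simp
      qed
      then show "(\<lambda>x. if x \<in> Y then g x else h x) \<in> free_perms n X \<and> (\<forall>y\<in>Y. (if y \<in> Y then g y else h y) = g y)"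
        using g h Y gY unfolding free_perms_def by (auto simp: funpow_glue)
    qed
  qed auto
qed

lemma card_by_value:
  assumes "finite A" "finite B" "\<And>a. a \<in> A \<Longrightarrow> \<phi> a \<in> B"
  shows "card A = (\<Sum>b\<in>B. card {a \<in> A. \<phi> a = b})"
proof -
  have "\<phi> ` A \<subseteq> B" using assms(3) by auto
  then show ?thesis using sum.group[OF assms(1,2), of \<phi> "\<lambda>_. 1::nat"] by simp
qed

lemma card_free_perms_2_rec:
  assumes "finite X" "a \<in> X"
  shows "card (free_perms 2 X) = (\<Sum>y\<in>X - {a}. card (free_perms 2 (X - {a, y})))"
proof -
  have "card (free_perms 2 X) = (\<Sum>y\<in>X - {a}. card {f \<in> free_perms 2 X. f a = y})"
    using assms free_perms_in[of _ 2 X a]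
    by (intro card_by_value finite_free_perms) (auto simp: free_perms_def)
  also have "\<dots> = (\<Sum>y\<in>X - {a}. card (free_perms 2 (X - {a, y})))"
  proof (rule sum.cong)
    fix y assume y: "y \<in> X - {a}"
    have g: "id(a := y, y := a) \<in> free_perms 2 {a, y}"
      using y by (auto simp: free_perms_def eval_nat_numeral)
    have "{f \<in> free_perms 2 X. f a = y} = {f \<in> free_perms 2 X. \<forall>z\<in>{a, y}. f z = (id(a := y, y := a)) z}"
      using y by (auto simp: free_perms_def eval_nat_numeral)
    then show "card {f \<in> free_perms 2 X. f a = y} = card (free_perms 2 (X - {a, y}))"
      using card_free_perms_fixed_part[OF g, of X] y assms by auto
  qed simp
  finally show ?thesis .
qed

lemma card_free_perms_3_rec:
  assumes "finite X" "a \<in> X"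
  shows "card (free_perms 3 X) =
    (\<Sum>(y, z)\<in>(SIGMA y:X - {a}. X - {a, y}). card (free_perms 3 (X - {a, y, z})))"
proof -
  have *: "card (free_perms 3 X) = (\<Sum>p\<in>(SIGMA y:X - {a}. X - {a, y}). card {f \<in> free_perms 3 X. (f a, f (f a)) = p})"
  proof (rule card_by_value)
    fix f assume f: "f \<in> free_perms 3 X"
    then have "f (f (f x)) = x" "f x = x \<longleftrightarrow> x \<notin> X" for x by (auto simp: free_perms_def eval_nat_numeral)
    moreover have "f a \<in> X" "f (f a) \<in> X" using free_perms_in[OF f] assms by auto
    ultimately show "(f a, f (f a)) \<in> (SIGMA y:X - {a}. X - {a, y})" using assms(2)
      by (metis Diff_iff SigmaI insert_iff singletonD)
  qed (use assms in \<open>auto intro: finite_free_perms\<close>)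
  also have "\<dots> = (\<Sum>(y, z)\<in>(SIGMA y:X - {a}. X - {a, y}). card (free_perms 3 (X - {a, y, z})))"
  proof (rule sum.cong)
    fix p assume p: "p \<in> (SIGMA y:X - {a}. X - {a, y})"
    obtain y z where p': "p = (y, z)" by (cases p)
    have yz: "y \<in> X" "z \<in> X" "y \<noteq> a" "z \<noteq> a" "y \<noteq> z" using p by (auto simp: p')
    let ?g = "id(a := y, y := z, z := a)"
    have g: "?g \<in> free_perms 3 {a, y, z}"
      using yz by (auto simp: free_perms_def eval_nat_numeral)
    have "{f \<in> free_perms 3 X. (f a, f (f a)) = (y, z)} = {f \<in> free_perms 3 X. \<forall>x\<in>{a, y, z}. f x = ?g x}"
      using yz by (auto simp: free_perms_def eval_nat_numeral)
    then show "card {f \<in> free_perms 3 X. (f a, f (f a)) = p} =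
        (case p of (y, z) \<Rightarrow> card (free_perms 3 (X - {a, y, z})))"
      using card_free_perms_fixed_part[OF g, of X] yz assms by (auto simp: p')
  qed simp
  finally show ?thesis .
qed

text \<open>The number of perfect matchings of 2k points, (2k)! / (2^k k!), in a form without
  division: the partner of a fixed point can be chosen in 2k - 1 ways.\<close>

lemma card_free_perms_2:
  assumes "finite X"
  shows "card X = 2 * k \<Longrightarrow> card (free_perms 2 X) * (2 ^ k * fact k) = fact (2 * k)"
    and "odd (card X) \<Longrightarrow> card (free_perms 2 X) = 0"
proof -
  have "(\<forall>k. card X = 2 * k \<longrightarrow> card (free_perms 2 X) * (2 ^ k * fact k) = fact (2 * k)) \<and>
      (odd (card X) \<longrightarrow> card (free_perms 2 X) = 0)"
    using assms
  proof (induction "card X" arbitrary: X rule: less_induct)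
    case less
    show ?case
    proof (cases "X = {}")
      case True
      then show ?thesis by (simp add: free_perms_empty)
    next
      case False
      then obtain a where a: "a \<in> X" by auto
      have c: "card (X - {a, y}) = card X - 2 \<and> card X \<ge> 2" if "y \<in> X - {a}" for y
        using that a less.prems card_Diff_subset[of "{a, y}" X] card_mono[of X "{a, y}"] by auto
      have cX: "card X > 0" using a less.prems by (auto simp: card_gt_0_iff)
      have IH: "(\<forall>k. card X = 2 * Suc k \<longrightarrow> card (free_perms 2 (X - {a, y})) * (2 ^ k * fact k) = fact (2 * k)) \<and>
          (odd (card X) \<longrightarrow> card (free_perms 2 (X - {a, y})) = 0)" if "y \<in> X - {a}" for y
        using less.hyps[of "X - {a, y}"] c[OF that] less.prems cX by auto
      show ?thesis
      proof (intro conjI allI impI)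
        fix k assume k: "card X = 2 * k"
        then obtain j where j: "k = Suc j" using cX by (cases k) auto
        have "card (free_perms 2 X) * (2 ^ j * fact j) =
            (\<Sum>y\<in>X - {a}. card (free_perms 2 (X - {a, y})) * (2 ^ j * fact j))"
          by (simp add: card_free_perms_2_rec[OF less.prems a] sum_distrib_right)
        also have "\<dots> = (\<Sum>y\<in>X - {a}. fact (2 * j))"
          using IH k by (intro sum.cong) (auto simp: j)
        also have "\<dots> = (2 * j + 1) * fact (2 * j)"
          using k a less.prems by (simp add: j)
        finally have e: "card (free_perms 2 X) * (2 ^ j * fact j) = (2 * j + 1) * fact (2 * j)" .
        have "card (free_perms 2 X) * (2 ^ k * fact k) = (2 * j + 2) * (card (free_perms 2 X) * (2 ^ j * fact j))"
          by (simp add: j algebra_simps)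
        then show "card (free_perms 2 X) * (2 ^ k * fact k) = fact (2 * k)"
          unfolding e by (simp add: j algebra_simps)
      qed (use card_free_perms_2_rec[OF less.prems a] IH in auto)
    qed
  qed
  then show "card X = 2 * k \<Longrightarrow> card (free_perms 2 X) * (2 ^ k * fact k) = fact (2 * k)"
    "odd (card X) \<Longrightarrow> card (free_perms 2 X) = 0" by auto
qed

lemma card_free_perms_3:
  assumes "finite X"
  shows "card X = 3 * k \<Longrightarrow> card (free_perms 3 X) * (3 ^ k * fact k) = fact (3 * k)"
    and "\<not> 3 dvd card X \<Longrightarrow> card (free_perms 3 X) = 0"
proof -
  have "(\<forall>k. card X = 3 * k \<longrightarrow> card (free_perms 3 X) * (3 ^ k * fact k) = fact (3 * k)) \<and>
      (\<not> 3 dvd card X \<longrightarrow> card (free_perms 3 X) = 0)"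
    using assms
  proof (induction "card X" arbitrary: X rule: less_induct)
    case less
    show ?case
    proof (cases "X = {}")
      case True
      then show ?thesis by (simp add: free_perms_empty)
    next
      case False
      then obtain a where a: "a \<in> X" by auto
      let ?P = "SIGMA y:X - {a}. X - {a, y}"
      have c: "card (X - {a, y, z}) = card X - 3 \<and> card X \<ge> 3" if "(y, z) \<in> ?P" for y z
      proof -
        have "card {a, y, z} = 3" "{a, y, z} \<subseteq> X" using that a by auto
        then show ?thesis using less.prems card_Diff_subset[of "{a, y, z}" X] card_mono[of X "{a, y, z}"] by auto
      qed
      have cP: "card ?P = (card X - 1) * (card X - 2)"
      proof -
        have "card (X - {a, y}) = card X - 2" if "y \<in> X - {a}" for y
          using that a less.prems card_Diff_subset[of "{a, y}" X] by auto
        then have "(\<Sum>y\<in>X - {a}. card (X - {a, y})) = (\<Sum>y\<in>X - {a}. card X - 2)"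
          by (intro sum.cong) auto
        then show ?thesis using less.prems a by simp
      qed
      have cX: "card X > 0" using a less.prems by (auto simp: card_gt_0_iff)
      have d: "3 dvd card X - 3 \<longleftrightarrow> 3 dvd card X" if "card X \<ge> 3"
        using that by (metis dvd_diffD dvd_diff_nat dvd_refl)
      have IH: "(\<forall>k. card X = 3 * Suc k \<longrightarrow> card (free_perms 3 (X - {a, y, z})) * (3 ^ k * fact k) = fact (3 * k)) \<and>
          (\<not> 3 dvd card X \<longrightarrow> card (free_perms 3 (X - {a, y, z})) = 0)" if "(y, z) \<in> ?P" for y z
        using less.hyps[of "X - {a, y, z}"] c[OF that] less.prems cX d by auto
      show ?thesis
      proof (intro conjI allI impI)
        fix k assume k: "card X = 3 * k"
        then obtain j where j: "k = Suc j" using cX by (cases k) auto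
        have "card (free_perms 3 X) * (3 ^ j * fact j) =
            (\<Sum>(y, z)\<in>?P. card (free_perms 3 (X - {a, y, z})) * (3 ^ j * fact j))"
          by (simp add: card_free_perms_3_rec[OF less.prems a] sum_distrib_right case_prod_unfold)
        also have "\<dots> = (\<Sum>(y, z)\<in>?P. fact (3 * j))"
          using IH k by (intro sum.cong) (auto simp: j)
        also have "\<dots> = ((3 * j + 2) * (3 * j + 1)) * fact (3 * j)"
          using cP k by (simp add: j case_prod_unfold del: card_SigmaI)
        finally have e: "card (free_perms 3 X) * (3 ^ j * fact j) = (3 * j + 2) * (3 * j + 1) * fact (3 * j)" .
        have "card (free_perms 3 X) * (3 ^ k * fact k) = (3 * j + 3) * (card (free_perms 3 X) * (3 ^ j * fact j))"
          by (simp add: j algebra_simps)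
        also have "\<dots> = (3 * j + 3) * ((3 * j + 2) * (3 * j + 1) * fact (3 * j))"
          unfolding e ..
        also have "\<dots> = fact (3 * k)"
        proof -
          have "3 * k = Suc (Suc (Suc (3 * j)))" by (simp add: j)
          then show ?thesis by (simp add: algebra_simps)
        qed
        finally show "card (free_perms 3 X) * (3 ^ k * fact k) = fact (3 * k)" .
      next
        assume "\<not> 3 dvd card X"
        then have "(case p of (y, z) \<Rightarrow> card (free_perms 3 (X - {a, y, z}))) = 0" if "p \<in> ?P" for p
          using IH[of "fst p" "snd p"] that by (cases p) simp
        then show "card (free_perms 3 X) = 0"
          unfolding card_free_perms_3_rec[OF less.prems a] by (rule sum.neutral[rule_format])
      qed
    qed
  qed
  then show "card X = 3 * k \<Longrightarrow> card (free_perms 3 X) * (3 ^ k * fact k) = fact (3 * k)"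
    "\<not> 3 dvd card X \<Longrightarrow> card (free_perms 3 X) = 0" by auto
qed

section \<open>Counting injections\<close>

lemma card_inj_fixed_value:
  assumes "x \<notin> S" "y \<in> T"
  shows "card {f \<in> insert x S \<rightarrow>\<^sub>E T. inj_on f (insert x S) \<and> f x = y} =
    card {f \<in> S \<rightarrow>\<^sub>E (T - {y}). inj_on f S}"
proof (rule bij_betw_same_card)
  show "bij_betw (\<lambda>f. f(x := undefined)) {f \<in> insert x S \<rightarrow>\<^sub>E T. inj_on f (insert x S) \<and> f x = y}
      {f \<in> S \<rightarrow>\<^sub>E (T - {y}). inj_on f S}"
  proof (rule bij_betw_byWitness[where f' = "\<lambda>f. f(x := y)"])
    show "(\<lambda>f. f(x := undefined)) ` {f \<in> insert x S \<rightarrow>\<^sub>E T. inj_on f (insert x S) \<and> f x = y}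
        \<subseteq> {f \<in> S \<rightarrow>\<^sub>E (T - {y}). inj_on f S}"
    proof (rule image_subsetI)
      fix f assume "f \<in> {f \<in> insert x S \<rightarrow>\<^sub>E T. inj_on f (insert x S) \<and> f x = y}"
      then have f: "f \<in> insert x S \<rightarrow>\<^sub>E T" "inj_on f (insert x S)" "f x = y" by auto
      have "inj_on (f(x := undefined)) S \<longleftrightarrow> inj_on f S"
        using assms(1) by (intro inj_on_cong) auto
      then show "f(x := undefined) \<in> {f \<in> S \<rightarrow>\<^sub>E (T - {y}). inj_on f S}"
        using f assms(1) by (auto simp: PiE_iff extensional_def image_iff)
    qed
    show "(\<lambda>f. f(x := y)) ` {f \<in> S \<rightarrow>\<^sub>E (T - {y}). inj_on f S}
        \<subseteq> {f \<in> insert x S \<rightarrow>\<^sub>E T. inj_on f (insert x S) \<and> f x = y}"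
      using assms by (auto simp: PiE_iff extensional_def inj_on_def split: if_splits)
    show "\<forall>f\<in>{f \<in> S \<rightarrow>\<^sub>E (T - {y}). inj_on f S}. f(x := y, x := undefined) = f"
      using assms(1) by (auto simp: PiE_iff extensional_def)
  qed auto
qed

lemma card_inj_extensional:
  assumes "finite S" "finite T" "card S \<le> card T"
  shows "card {f \<in> S \<rightarrow>\<^sub>E T. inj_on f S} * fact (card T - card S) = fact (card T)"
  using assms
proof (induction S arbitrary: T rule: finite_induct)
  case empty
  then show ?case by (simp add: PiE_def)
next
  case (insert x S)
  let ?A = "{f \<in> insert x S \<rightarrow>\<^sub>E T. inj_on f (insert x S)}"
  have T: "card T > 0" and c: "card (insert x S) = Suc (card S)" using insert by auto
  have "finite ?A" using insert.hyps insert.prems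
    by (intro finite_subset[OF _ finite_PiE[of "insert x S" "\<lambda>_. T"]]) auto
  then have "card ?A = (\<Sum>y\<in>T. card {f \<in> ?A. f x = y})"
    using insert.prems by (intro card_by_value) auto
  also have "\<dots> = (\<Sum>y\<in>T. card {f \<in> S \<rightarrow>\<^sub>E (T - {y}). inj_on f S})"
    using card_inj_fixed_value[OF insert.hyps(2), of _ T]
    by (intro sum.cong) (auto simp: conj_assoc)
  finally have "card ?A * fact (card T - card (insert x S)) =
      (\<Sum>y\<in>T. card {f \<in> S \<rightarrow>\<^sub>E (T - {y}). inj_on f S} * fact (card (T - {y}) - card S))"
    using insert.prems by (simp add: sum_distrib_right c)
  also have "\<dots> = (\<Sum>y\<in>T. fact (card T - 1))"
  proof (rule sum.cong)
    fix y assume "y \<in> T"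
    then have "card (T - {y}) = card T - 1" "card S \<le> card (T - {y})" "finite (T - {y})"
      using insert.prems by (simp_all add: c)
    then show "card {f \<in> S \<rightarrow>\<^sub>E (T - {y}). inj_on f S} * fact (card (T - {y}) - card S) = fact (card T - 1)"
      using insert.IH[of "T - {y}"] by metis
  qed simp
  also have "\<dots> = fact (card T)"
    using T by (cases "card T") auto
  finally show ?case .
qed

section \<open>The recurrence for the number of free subgroups\<close>

definition free_pairs :: "'x set \<Rightarrow> (('x \<Rightarrow> 'x) \<times> ('x \<Rightarrow> 'x)) set" where
  "free_pairs X = free_perms 2 X \<times> free_perms 3 X"

lemma free_pairs_modular_action:
  "(\<sigma>, \<tau>) \<in> free_pairs X \<Longrightarrow> modular_action \<sigma> \<tau>"
  by (simp add: free_pairs_def free_perms_def modular_action_def eval_nat_numeral)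

lemma finite_free_pairs: "finite X \<Longrightarrow> finite (free_pairs X)"
  by (simp add: free_pairs_def finite_free_perms)

text \<open>This is \<open>(6n)! / ((3n)! (2n)!)\<close>, in a form that shows that \<open>n!\<close> divides it.\<close>

definition weight :: "nat \<Rightarrow> nat" where
  "weight n = ((6 * n) choose (3 * n)) * ((3 * n) choose (2 * n)) * fact n"

lemma weight_fact: "weight n * (fact (3 * n) * fact (2 * n)) = fact (6 * n)"
proof -
  have 6: "fact (3 * n) * fact (3 * n) * ((6 * n) choose (3 * n)) = fact (6 * n)"
    using binomial_fact_lemma[of "3 * n" "6 * n"] by simp
  have 3: "fact (2 * n) * fact n * ((3 * n) choose (2 * n)) = fact (3 * n)"
    using binomial_fact_lemma[of "2 * n" "3 * n"] by simp
  have "weight n * (fact (3 * n) * fact (2 * n)) =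
      fact (3 * n) * (fact (2 * n) * fact n * ((3 * n) choose (2 * n))) * ((6 * n) choose (3 * n))"
    unfolding weight_def by (simp only: ac_simps)
  then show ?thesis unfolding 3 6 .
qed

lemma card_free_pairs:
  assumes "finite X" "card X = 6 * n"
  shows "card (free_pairs X) * 72 ^ n = fact (6 * n) * weight n"
proof -
  let ?a = "card (free_perms 2 X)" and ?b = "card (free_perms 3 X)"
  have 2: "?a * (2 ^ (3 * n) * fact (3 * n)) = fact (6 * n)"
    using card_free_perms_2(1)[of X "3 * n"] assms by simp
  have 3: "?b * (3 ^ (2 * n) * fact (2 * n)) = fact (6 * n)"
    using card_free_perms_3(1)[of X "2 * n"] assms by simp
  \<comment> \<open>The powers of 2 and 3 come from rotating each of the 3n transpositions and each
    of the 2n three-cycles.\<close>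
  have p: "(72::nat) ^ n = 2 ^ (3 * n) * 3 ^ (2 * n)"
    by (simp add: power_mult flip: power_mult_distrib)
  have "card (free_pairs X) * 72 ^ n * (fact (3 * n) * fact (2 * n)) =
      (?a * (2 ^ (3 * n) * fact (3 * n))) * (?b * (3 ^ (2 * n) * fact (2 * n)))"
    unfolding free_pairs_def card_cartesian_product p by (simp only: ac_simps)
  also have "\<dots> = fact (6 * n) * weight n * (fact (3 * n) * fact (2 * n))"
    unfolding 2 3 by (simp add: mult.assoc weight_fact)
  finally show ?thesis by simp
qed

lemma card_free_pairs_eq_0:
  assumes "finite X" "\<not> 6 dvd card X"
  shows "card (free_pairs X) = 0"
proof -
  have "odd (card X) \<or> \<not> 3 dvd card X" using assms(2) by presburger
  then show ?thesis
    using card_free_perms_2(2)[OF assms(1)] card_free_perms_3(2)[OF assms(1)]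
    by (auto simp: free_pairs_def card_cartesian_product)
qed

text \<open>The closed formula is used instead of transporting permutations along a bijection; when
  6 does not divide the cardinality, both sides are 0.\<close>

lemma card_free_pairs_cong:
  assumes "finite X" "finite Y" "card X = card Y"
  shows "card (free_pairs X) = card (free_pairs Y)"
proof (cases "6 dvd card X")
  case True
  then obtain n where "card X = 6 * n" by auto
  then have "card (free_pairs X) * 72 ^ n = card (free_pairs Y) * 72 ^ n"
    using card_free_pairs assms by metis
  then show ?thesis by simp
next
  case False
  then show ?thesis using card_free_pairs_eq_0 assms by metis
qed

context modular_generators
begin

text \<open>
  A pair of free permutations of \<open>X\<close> is compatible with exactly one marking based at \<open>x\<close>: the
  stabilizer of \<open>x\<close> with the orbit map.
\<close>

definition markings :: "'a set \<Rightarrow> 'x set \<Rightarrow> 'x \<Rightarrow> ('a set \<Rightarrow> 'x) set" where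
  "markings H X x = {b \<in> rcosets H \<rightarrow>\<^sub>E X. inj_on b (rcosets H) \<and> b H = x}"

text \<open>Equivariance of \<open>b\<close> with respect to the action on cosets. It constrains the
  permutations only on the image of \<open>b\<close>.\<close>

definition compatible :: "'a set \<Rightarrow> ('a set \<Rightarrow> 'x) \<Rightarrow> (('x \<Rightarrow> 'x) \<times> ('x \<Rightarrow> 'x)) set" where
  "compatible H b = {(\<sigma>, \<tau>). \<forall>C\<in>rcosets H. \<sigma> (b C) = b (C #> s) \<and> \<tau> (b C) = b (C #> u)}"

definition torsion_free_subgroups :: "nat \<Rightarrow> 'a set set" where
  "torsion_free_subgroups k =
    {H. subgroup H G \<and> finite (rcosets H) \<and> card (rcosets H) = k \<and> avoids_torsion H}"

lemma compatible_act:
  assumes H: "subgroup H G" and c: "(\<sigma>, \<tau>) \<in> compatible H b" and m: "modular_action \<sigma> \<tau>"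
    and C: "C \<in> rcosets H" and g: "g \<in> carrier G"
  shows "b (C #> g) = act \<sigma> \<tau> g (b C)"
proof -
  obtain w where w: "ev w = g" using generated[OF g] by auto
  have "b (C #> ev w) = run \<sigma> \<tau> w (b C)"
    using C
  proof (induction w arbitrary: C)
    case Nil
    then show ?case using rcosets_subset[OF H Nil] by simp
  next
    case (Cons e w)
    have "C #> ev (e # w) = C #> (if e then s else u) #> ev w"
      using rcosets_subset[OF H Cons.prems] by (simp add: coset_mult_assoc)
    moreover have "C #> (if e then s else u) \<in> rcosets H"
      using rcosets_r_coset[OF H Cons.prems] by simp
    moreover have "b (C #> (if e then s else u)) = (if e then \<sigma> (b C) else \<tau> (b C))"
      using c Cons.prems by (auto simp: compatible_def)
    ultimately show ?case using Cons.IH by simp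
  qed
  then show ?thesis using act_ev[OF m, of w] w by simp
qed

lemma subgroup_in_rcosets: "subgroup H G \<Longrightarrow> H \<in> rcosets H"
  using subgroup.subgroup_in_rcosets is_group by blast

lemma coset_one: "subgroup H G \<Longrightarrow> H #> \<one> = H"
  using subgroup.subset coset_mult_one by blast

lemma marking_stabilizer:
  assumes H: "subgroup H G" and b: "b \<in> markings H X x"
    and c: "(\<sigma>, \<tau>) \<in> compatible H b" and m: "modular_action \<sigma> \<tau>" and g: "g \<in> carrier G"
  shows "b (H #> g) = act \<sigma> \<tau> g x" and "g \<in> H \<longleftrightarrow> act \<sigma> \<tau> g x = x"
proof -
  have HR: "H \<in> rcosets H" using subgroup_in_rcosets[OF H] .
  show *: "b (H #> g) = act \<sigma> \<tau> g x"
    using compatible_act[OF H c m HR g] b by (simp add: markings_def)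
  have "H #> g \<in> rcosets H" using rcosets_r_coset[OF H HR g] .
  then have "b (H #> g) = b H \<longleftrightarrow> H #> g = H"
    using b HR unfolding markings_def by (auto dest: inj_onD)
  also have "\<dots> \<longleftrightarrow> g \<in> H"
    using coset_join1[of H g] coset_join2[OF g H] g subgroup.subset[OF H] H by blast
  finally show "g \<in> H \<longleftrightarrow> act \<sigma> \<tau> g x = x"
    using * b by (auto simp: markings_def)
qed

lemma marking_unique:
  assumes H: "subgroup H G" "b \<in> markings H X x" "(\<sigma>, \<tau>) \<in> compatible H b"
    and H': "subgroup H' G" "b' \<in> markings H' X x" "(\<sigma>, \<tau>) \<in> compatible H' b'"
    and m: "modular_action \<sigma> \<tau>"
  shows "H = H' \<and> b = b'"
proof -
  have eq: "H = H'"
    using marking_stabilizer(2)[OF H m] marking_stabilizer(2)[OF H' m]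
      subgroup.subset[OF H(1)] subgroup.subset[OF H'(1)] by blast
  have "b C = b' C" if C: "C \<in> rcosets H" for C
  proof -
    obtain g where "g \<in> carrier G" "C = H #> g" using rcosets_cases[OF H(1) C] .
    then show ?thesis
      using marking_stabilizer(1)[OF H m] marking_stabilizer(1)[OF H' m] eq by simp
  qed
  moreover have "b C = b' C" if "C \<notin> rcosets H" for C
    using that H(2) H'(2) eq by (auto simp: markings_def PiE_iff extensional_def)
  ultimately show ?thesis using eq by (auto simp: fun_eq_iff)
qed

lemma marking_exists:
  assumes p: "(\<sigma>, \<tau>) \<in> free_pairs X" and X: "finite X" "x \<in> X"
  shows "\<exists>k\<in>{1..card X}. \<exists>H\<in>torsion_free_subgroups k. \<exists>b\<in>markings H X x. (\<sigma>, \<tau>) \<in> compatible H b"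
proof -
  note m = free_pairs_modular_action[OF p]
  define H where "H = {g \<in> carrier G. act \<sigma> \<tau> g x = x}"
  have H: "subgroup H G"
  proof (rule subgroupI)
    fix g assume "g \<in> H"
    then have "g \<in> carrier G" "act \<sigma> \<tau> g x = x" by (auto simp: H_def)
    then show "inv g \<in> H" using act_inv[OF m, of g x] by (simp add: H_def)
  qed (auto simp: H_def act_mult[OF m] act_one[OF m] intro!: exI[of _ \<one>])
  have HR: "H \<in> rcosets H" using subgroup_in_rcosets[OF H] .
  \<comment> \<open>The orbit map on cosets. The representative picked by \<open>SOME\<close> does
    not matter because \<open>H\<close> fixes \<open>x\<close>; the restriction makes
    \<open>b\<close> extensional, as \<open>markings\<close> demands.\<close>
  define b where "b = (\<lambda>C\<in>rcosets H. act \<sigma> \<tau> (SOME g. g \<in> C) x)"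
  have bH: "b (H #> g) = act \<sigma> \<tau> g x" if g: "g \<in> carrier G" for g
  proof -
    have "g \<in> H #> g" using rcos_self[OF g H] .
    then have "(SOME h. h \<in> H #> g) \<in> H #> g" by (rule someI)
    then obtain h where h: "h \<in> H" "(SOME h. h \<in> H #> g) = h \<otimes> g" by (auto simp: r_coset_def)
    have "H #> g \<in> rcosets H" using rcosets_r_coset[OF H HR g] .
    then show ?thesis using h g by (simp add: b_def H_def act_mult[OF m])
  qed
  have act_X: "act \<sigma> \<tau> g y \<in> X" if g: "g \<in> carrier G" and y: "y \<in> X" for g y
  proof -
    obtain w where w: "ev w = g" using generated[OF g] by auto
    have cl: "\<sigma> z \<in> X" "\<tau> z \<in> X" if "z \<in> X" for z
      using p that free_perms_in[of \<sigma> 2 X z] free_perms_in[of \<tau> 3 X z] by (simp_all add: free_pairs_def)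
    have "run \<sigma> \<tau> w y \<in> X" using y
      by (induction w arbitrary: y) (simp_all add: cl)
    then show ?thesis using act_ev[OF m, of w] w by simp
  qed
  have bX: "b ` (rcosets H) \<subseteq> X"
    using bH act_X X(2) by (auto simp: RCOSETS_def)
  have inj: "inj_on b (rcosets H)"
  proof (rule inj_onI)
    fix C D assume CD: "C \<in> rcosets H" "D \<in> rcosets H" "b C = b D"
    obtain g where g: "g \<in> carrier G" "C = H #> g" using rcosets_cases[OF H CD(1)] .
    obtain h where h: "h \<in> carrier G" "D = H #> h" using rcosets_cases[OF H CD(2)] .
    have "act \<sigma> \<tau> (g \<otimes> inv h) x = x"
      using CD(3) g h act_inv[OF m, of h x] by (simp add: bH act_mult[OF m])
    then show "C = D" using g h r_coset_eq_iff[OF H] by (simp add: H_def)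
  qed
  have "b H = x" using bH[OF one_closed] coset_one[OF H] act_one[OF m] by simp
  then have "b \<in> markings H X x"
    using inj bX by (auto simp: markings_def b_def)
  moreover have "(\<sigma>, \<tau>) \<in> compatible H b"
  proof -
    have "\<sigma> (b C) = b (C #> s) \<and> \<tau> (b C) = b (C #> u)" if C: "C \<in> rcosets H" for C
    proof -
      obtain g where g: "g \<in> carrier G" "C = H #> g" using rcosets_cases[OF H C] .
      have "C #> s = H #> (g \<otimes> s)" "C #> u = H #> (g \<otimes> u)"
        using g subgroup.subset[OF H] by (simp_all add: coset_mult_assoc)
      then show ?thesis using g bH by (simp add: act_mult[OF m] act_s[OF m] act_u[OF m])
    qed
    then show ?thesis by (auto simp: compatible_def)
  qed
  moreover have "finite (rcosets H)" using inj_on_finite[OF inj bX X(1)] .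
  moreover have "card (rcosets H) \<le> card X" using card_inj_on_le[OF inj bX X(1)] .
  moreover have "card (rcosets H) \<ge> 1"
    using HR \<open>finite (rcosets H)\<close> by (metis One_nat_def Suc_leI card_gt_0_iff empty_iff)
  moreover have "avoids_torsion H"
    unfolding avoids_torsion_def
  proof (intro ballI conjI notI)
    fix g assume g: "g \<in> carrier G"
    have y: "act \<sigma> \<tau> g x \<in> X" using act_X[OF g X(2)] .
    \<comment> \<open>If a conjugate of \<open>h\<close> by \<open>g\<close> stabilizes
      \<open>x\<close>, then \<open>h\<close> fixes the point reached from \<open>x\<close> by
      \<open>g\<close>. For \<open>s\<close> and \<open>u\<close> this contradicts the absence of
      fixed points in \<open>X\<close>.\<close>
    have *: "act \<sigma> \<tau> h (act \<sigma> \<tau> g x) = act \<sigma> \<tau> g x" if "g \<otimes> h \<otimes> inv g \<in> H" "h \<in> carrier G" for h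
    proof -
      have "act \<sigma> \<tau> (inv g) (act \<sigma> \<tau> h (act \<sigma> \<tau> g x)) = x"
        using that g by (simp add: H_def act_mult[OF m])
      then show ?thesis using act_inv'[OF m g] by metis
    qed
    have "\<sigma> (act \<sigma> \<tau> g x) \<noteq> act \<sigma> \<tau> g x" "\<tau> (act \<sigma> \<tau> g x) \<noteq> act \<sigma> \<tau> g x"
      using y p by (auto simp: free_pairs_def free_perms_def)
    then show "g \<otimes> s \<otimes> inv g \<in> H \<Longrightarrow> False" "g \<otimes> u \<otimes> inv g \<in> H \<Longrightarrow> False"
      using *[of s] *[of u] act_s[OF m] act_u[OF m] by auto
  qed
  ultimately show ?thesis using H unfolding torsion_free_subgroups_def
    by (intro bexI[of _ "card (rcosets H)"] bexI[of _ H] bexI[of _ b]) auto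
qed

text \<open>Transporting the action on cosets along \<open>b\<close> gives a pair of free
  permutations of the image of \<open>b\<close>. A compatible pair must agree with it there and is
  arbitrary on the complement.\<close>

lemma card_compatible:
  assumes H: "subgroup H G" "avoids_torsion H" and b: "b \<in> markings H X x" and X: "finite X"
  shows "card (free_pairs X \<inter> compatible H b) = card (free_pairs (X - b ` (rcosets H)))"
proof -
  let ?R = "rcosets H" and ?Y = "b ` (rcosets H)"
  have inj: "inj_on b ?R" and YX: "?Y \<subseteq> X" using b by (auto simp: markings_def)
  define \<sigma> where "\<sigma> x = (if x \<in> ?Y then b (inv_into ?R b x #> s) else x)" for x
  define \<tau> where "\<tau> x = (if x \<in> ?Y then b (inv_into ?R b x #> u) else x)" for x
  note R = coset_s_in[OF H(1)] coset_u_in[OF H(1)]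
  have \<sigma>b: "\<sigma> (b C) = b (C #> s)" and \<tau>b: "\<tau> (b C) = b (C #> u)" if "C \<in> ?R" for C
    using that inj by (simp_all add: \<sigma>_def \<tau>_def)
  have "\<sigma> (\<sigma> y) = y" for y
  proof (cases "y \<in> ?Y")
    case True
    then obtain C where "C \<in> ?R" "y = b C" by auto
    then show ?thesis using R coset_s_s[OF H(1)] by (simp add: \<sigma>b)
  qed (simp add: \<sigma>_def)
  moreover have "\<tau> (\<tau> (\<tau> y)) = y" for y
  proof (cases "y \<in> ?Y")
    case True
    then obtain C where "C \<in> ?R" "y = b C" by auto
    then show ?thesis using R coset_u_u_u[OF H(1)] by (simp add: \<tau>b)
  qed (simp add: \<tau>_def)
  moreover have "\<sigma> y = y \<longleftrightarrow> y \<notin> ?Y" "\<tau> y = y \<longleftrightarrow> y \<notin> ?Y" for y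
  proof -
    have "\<sigma> (b C) \<noteq> b C \<and> \<tau> (b C) \<noteq> b C" if C: "C \<in> ?R" for C
      using C R[OF C] coset_s_ne[OF H(1) C H(2)] coset_u_ne[OF H(1) C H(2)] inj
      by (auto simp: \<sigma>b \<tau>b dest: inj_onD)
    then show "\<sigma> y = y \<longleftrightarrow> y \<notin> ?Y" "\<tau> y = y \<longleftrightarrow> y \<notin> ?Y" by (auto simp: \<sigma>_def \<tau>_def)
  qed
  ultimately have fp: "\<sigma> \<in> free_perms 2 ?Y" "\<tau> \<in> free_perms 3 ?Y"
    by (auto simp: free_perms_def eval_nat_numeral)
  have "free_pairs X \<inter> compatible H b =
      {f \<in> free_perms 2 X. \<forall>y\<in>?Y. f y = \<sigma> y} \<times> {f \<in> free_perms 3 X. \<forall>y\<in>?Y. f y = \<tau> y}"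
    by (auto simp: free_pairs_def compatible_def \<sigma>b \<tau>b)
  then show ?thesis
    using card_free_perms_fixed_part[OF fp(1) YX] card_free_perms_fixed_part[OF fp(2) YX]
    by (simp add: card_cartesian_product free_pairs_def)
qed

lemma card_markings:
  assumes H: "subgroup H G" "finite (rcosets H)" and X: "finite X" "x \<in> X" "card (rcosets H) \<le> card X"
  shows "card (markings H X x) * fact (card X - card (rcosets H)) = fact (card X - 1)"
proof -
  let ?R = "rcosets H"
  have HR: "H \<in> ?R" using subgroup_in_rcosets[OF H(1)] .
  then have R: "insert H (?R - {H}) = ?R" by auto
  have c: "card (?R - {H}) = card ?R - 1" "card (X - {x}) = card X - 1" "card ?R > 0" "card X > 0"
    using H HR X by (auto simp: card_gt_0_iff)
  have "card (markings H X x) = card {f \<in> (?R - {H}) \<rightarrow>\<^sub>E (X - {x}). inj_on f (?R - {H})}"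
    using card_inj_fixed_value[of H "?R - {H}" x X] X(2) unfolding R markings_def by auto
  moreover have "card X - 1 - (card ?R - 1) = card X - card ?R" using c by simp
  ultimately show ?thesis
    using card_inj_extensional[of "?R - {H}" "X - {x}"] H X c by simp
qed

lemma finite_markings:
  assumes "finite (rcosets H)" "finite X"
  shows "finite (markings H X x)"
  unfolding markings_def
  by (rule finite_subset[OF _ finite_PiE[of "rcosets H" "\<lambda>_. X"]]) (use assms in auto)

text \<open>A numbering of the k cosets of \<open>H\<close> with base 0 turns the coset action into
  a pair of permutations of k points, and by \<open>marking_unique\<close> the pair determines
  \<open>H\<close>. There are only finitely many such pairs.\<close>

lemma finite_torsion_free_subgroups:
  assumes "k > 0"
  shows "finite (torsion_free_subgroups k)"
proof -
  let ?X = "{..<k}"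
  have "\<exists>p. p \<in> free_pairs ?X \<and> (\<exists>b\<in>markings H ?X 0. p \<in> compatible H b)"
    if "H \<in> torsion_free_subgroups k" for H
  proof -
    from that have H: "subgroup H G" "finite (rcosets H)" "card (rcosets H) = k" "avoids_torsion H"
      by (auto simp: torsion_free_subgroups_def)
    have "card (markings H ?X 0) * fact (card ?X - card (rcosets H)) = fact (card ?X - 1)"
      using H assms by (intro card_markings) auto
    then have "card (markings H ?X 0) > 0" by (metis fact_nonzero gr0I mult_0)
    then obtain b where b: "b \<in> markings H ?X 0" by (metis card.empty ex_in_conv less_numeral_extra(3))
    then have "inj_on b (rcosets H)" "b ` (rcosets H) \<subseteq> ?X" by (auto simp: markings_def)
    then have "b ` (rcosets H) = ?X" using H(3) by (intro card_subset_eq) (auto simp: card_image)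
    \<comment> \<open>The marking is onto, so nothing is left to choose on the empty
      complement.\<close>
    then have "card (free_pairs ?X \<inter> compatible H b) = 1"
      using card_compatible[OF H(1,4) b] by (simp add: free_pairs_def free_perms_empty)
    then show ?thesis using b by (metis Int_iff card_1_singletonE insertI1)
  qed
  then obtain p where p: "p H \<in> free_pairs ?X" "\<exists>b\<in>markings H ?X 0. p H \<in> compatible H b"
    if "H \<in> torsion_free_subgroups k" for H by metis
  have "inj_on p (torsion_free_subgroups k)"
  proof (rule inj_onI)
    fix H H' assume a: "H \<in> torsion_free_subgroups k" "H' \<in> torsion_free_subgroups k" "p H = p H'"
    obtain \<sigma> \<tau> where st: "p H = (\<sigma>, \<tau>)" by (cases "p H")
    obtain b b' where b: "b \<in> markings H ?X 0" "(\<sigma>, \<tau>) \<in> compatible H b"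
      and b': "b' \<in> markings H' ?X 0" "(\<sigma>, \<tau>) \<in> compatible H' b'"
      using p(2)[OF a(1)] p(2)[OF a(2)] a(3) st by auto
    have m: "modular_action \<sigma> \<tau>" using p(1)[OF a(1)] free_pairs_modular_action st by metis
    have H: "subgroup H G" "subgroup H' G" using a(1,2) by (auto simp: torsion_free_subgroups_def)
    show "H = H'" using marking_unique[OF H(1) b H(2) b' m] ..
  qed
  moreover have "p ` torsion_free_subgroups k \<subseteq> free_pairs ?X" using p(1) by auto
  ultimately show ?thesis by (rule inj_on_finite) (simp add: finite_free_pairs)
qed

text \<open>The pairs are sorted by their unique marking at the point 0. A subgroup of index k has
  (m-1)! / (m-k)! markings, and each leaves an arbitrary pair on the m - k points outside the orbit.
  Real numbers allow the falling factorial to be written as a quotient.\<close>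

lemma card_free_pairs_rec:
  assumes "m > 0"
  shows "card (free_pairs {..<m}) =
    (\<Sum>k = 1..m. real (card (torsion_free_subgroups k)) * (fact (m - 1) / fact (m - k)) *
       card (free_pairs {..<m - k}))"
proof -
  let ?X = "{..<m}"
  let ?I = "\<Union>k\<in>{1..m}. torsion_free_subgroups k"
  let ?P = "SIGMA H:?I. markings H ?X 0"
  have I: "subgroup H G" "finite (rcosets H)" "avoids_torsion H" "card (rcosets H) \<le> m"
    if "H \<in> ?I" for H using that by (auto simp: torsion_free_subgroups_def)
  have finI: "finite ?I" using finite_torsion_free_subgroups by auto
  have finM: "finite (markings H ?X 0)" if "H \<in> ?I" for H
    by (rule finite_markings[OF I(2)[OF that]]) simp
  have "free_pairs ?X = (\<Union>(H, b)\<in>?P. free_pairs ?X \<inter> compatible H b)"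
  proof
    show "free_pairs ?X \<subseteq> (\<Union>(H, b)\<in>?P. free_pairs ?X \<inter> compatible H b)"
    proof
      fix p assume p: "p \<in> free_pairs ?X"
      obtain \<sigma> \<tau> where st: "p = (\<sigma>, \<tau>)" by (cases p)
      from marking_exists[of \<sigma> \<tau> ?X 0] p assms obtain k H b where
        "k \<in> {1..m}" "H \<in> torsion_free_subgroups k" "b \<in> markings H ?X 0" "p \<in> compatible H b"
        unfolding st by auto
      then show "p \<in> (\<Union>(H, b)\<in>?P. free_pairs ?X \<inter> compatible H b)" using p by blast
    qed
  qed auto
  then have "card (free_pairs ?X) = card (\<Union>p\<in>?P. free_pairs ?X \<inter> compatible (fst p) (snd p))"
    by (simp add: case_prod_unfold)
  also have "\<dots> = (\<Sum>p\<in>?P. card (free_pairs ?X \<inter> compatible (fst p) (snd p)))"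
  proof (rule card_UN_disjoint)
    show "finite ?P" using finI finM by auto
    show "\<forall>p\<in>?P. finite (free_pairs ?X \<inter> compatible (fst p) (snd p))" using finite_free_pairs by auto
    show "\<forall>p\<in>?P. \<forall>q\<in>?P. p \<noteq> q \<longrightarrow>
        (free_pairs ?X \<inter> compatible (fst p) (snd p)) \<inter> (free_pairs ?X \<inter> compatible (fst q) (snd q)) = {}"
    proof (intro ballI impI equals0I)
      fix p q r assume pq: "p \<in> ?P" "q \<in> ?P" "p \<noteq> q"
        and r: "r \<in> (free_pairs ?X \<inter> compatible (fst p) (snd p)) \<inter> (free_pairs ?X \<inter> compatible (fst q) (snd q))"
      obtain \<sigma> \<tau> where st: "r = (\<sigma>, \<tau>)" by (cases r)
      have pI: "fst p \<in> ?I" and qI: "fst q \<in> ?I" using pq by auto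
      have p: "subgroup (fst p) G" "snd p \<in> markings (fst p) ?X 0" "(\<sigma>, \<tau>) \<in> compatible (fst p) (snd p)"
        using pq(1) r I(1)[OF pI] unfolding st by auto
      have q: "subgroup (fst q) G" "snd q \<in> markings (fst q) ?X 0" "(\<sigma>, \<tau>) \<in> compatible (fst q) (snd q)"
        using pq(2) r I(1)[OF qI] unfolding st by auto
      have "modular_action \<sigma> \<tau>" using r unfolding st by (intro free_pairs_modular_action[of _ _ ?X]) simp
      from marking_unique[OF p q this] show False using pq(3) by (simp add: prod_eq_iff)
    qed
  qed
  also have "\<dots> = (\<Sum>p\<in>?P. card (free_pairs {..<m - card (rcosets (fst p))}))"
  proof (rule sum.cong)
    fix p assume p: "p \<in> ?P"
    then have m: "fst p \<in> ?I" "snd p \<in> markings (fst p) ?X 0" by auto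
    then have inj: "inj_on (snd p) (rcosets (fst p))" "snd p ` (rcosets (fst p)) \<subseteq> ?X" by (auto simp: markings_def)
    then have "card (?X - snd p ` (rcosets (fst p))) = m - card (rcosets (fst p))"
      using I(2)[OF m(1)] by (subst card_Diff_subset) (auto simp: card_image)
    then show "card (free_pairs ?X \<inter> compatible (fst p) (snd p)) = card (free_pairs {..<m - card (rcosets (fst p))})"
      using card_compatible[OF I(1,3)[OF m(1)] m(2)]
      by (metis card_free_pairs_cong card_lessThan finite_Diff finite_lessThan)
  qed simp
  also have "\<dots> = (\<Sum>H\<in>?I. card (markings H ?X 0) * card (free_pairs {..<m - card (rcosets H)}))"
    by (subst sum.Sigma[symmetric, of ?I "\<lambda>H. markings H ?X 0" "\<lambda>H b. card (free_pairs {..<m - card (rcosets H)})",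
          simplified case_prod_unfold]) (use finI finM in auto)
  also have "\<dots> = (\<Sum>k\<in>{1..m}. \<Sum>H\<in>torsion_free_subgroups k.
      card (markings H ?X 0) * card (free_pairs {..<m - card (rcosets H)}))"
    by (rule sum.UNION_disjoint) (auto simp: finite_torsion_free_subgroups, auto simp: torsion_free_subgroups_def)
  finally have "card (free_pairs ?X) = (\<Sum>k\<in>{1..m}. \<Sum>H\<in>torsion_free_subgroups k.
      card (markings H ?X 0) * card (free_pairs {..<m - card (rcosets H)}))" .
  also have "real \<dots> = (\<Sum>k = 1..m. \<Sum>H\<in>torsion_free_subgroups k.
      (fact (m - 1) / fact (m - k)) * card (free_pairs {..<m - k}))"
    unfolding of_nat_sum
  proof (intro sum.cong refl)
    fix k H assume k: "k \<in> {1..m}" and "H \<in> torsion_free_subgroups k"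
    then have H: "subgroup H G" "finite (rcosets H)" "card (rcosets H) = k"
      by (auto simp: torsion_free_subgroups_def)
    have "card (markings H ?X 0) * fact (m - k) = fact (m - 1)"
      using card_markings[OF H(1,2), of ?X 0] H(3) k assms by simp
    then have "real (card (markings H ?X 0)) * fact (m - k) = fact (m - 1)"
      by (metis of_nat_fact of_nat_mult)
    then have "real (card (markings H ?X 0)) = fact (m - 1) / fact (m - k)"
      by (simp add: field_simps)
    then show "real (card (markings H ?X 0) * card (free_pairs {..<m - card (rcosets H)})) =
        fact (m - 1) / fact (m - k) * card (free_pairs {..<m - k})"
      using H(3) by simp
  qed
  finally show ?thesis by (simp add: mult.assoc)
qed

text \<open>In \<open>card_free_pairs_rec\<close> for 6n points, only orbits of size divisible by 6
  contribute. Multiplication by \<open>72 ^ n\<close> expresses the pair counts through weights, the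
  factorials (6n-6l)! cancel, and dividing by (6n-1)! leaves the factor 6n on the left.\<close>

lemma weight_rec:
  assumes "n > 0"
  shows "6 * n * weight n =
    (\<Sum>l = 1..n. card (torsion_free_subgroups (6 * l)) * 72 ^ l * weight (n - l))"
proof -
  let ?f = "\<lambda>k. real (card (torsion_free_subgroups k))"
  define c where "c j = real (card (free_pairs {..<j :: nat}))" for j
  have c6: "c (6 * j) * 72 ^ j = fact (6 * j) * weight j" for j
  proof -
    have "card (free_pairs {..<6 * j}) * 72 ^ j = fact (6 * j) * weight j"
      by (rule card_free_pairs) auto
    then have "real (card (free_pairs {..<6 * j}) * 72 ^ j) = real (fact (6 * j) * weight j)" by simp
    then show ?thesis by (simp add: c_def)
  qed
  have c0: "c j = 0" if "\<not> 6 dvd j" for j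
    using card_free_pairs_eq_0[of "{..<j}"] that by (simp add: c_def)
  have "c (6 * n) = (\<Sum>k = 1..6 * n. ?f k * (fact (6 * n - 1) / fact (6 * n - k)) * c (6 * n - k))"
    using card_free_pairs_rec[of "6 * n"] assms unfolding c_def by simp
  also have "\<dots> = (\<Sum>k \<in> (*) 6 ` {1..n}. ?f k * (fact (6 * n - 1) / fact (6 * n - k)) * c (6 * n - k))"
  proof (rule sum.mono_neutral_right)
    show "\<forall>k\<in>{1..6 * n} - (*) 6 ` {1..n}. ?f k * (fact (6 * n - 1) / fact (6 * n - k)) * c (6 * n - k) = 0"
    proof
      fix k assume k: "k \<in> {1..6 * n} - (*) 6 ` {1..n}"
      have "\<not> 6 dvd k"
      proof
        assume "6 dvd k"
        then obtain j where "k = 6 * j" by auto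
        then show False using k by auto
      qed
      then have "\<not> 6 dvd 6 * n - k" using k by (auto dest: dvd_diffD1[of 6 "6 * n" k])
      then show "?f k * (fact (6 * n - 1) / fact (6 * n - k)) * c (6 * n - k) = 0" by (simp add: c0)
    qed
  qed auto
  also have "\<dots> = (\<Sum>l = 1..n. ?f (6 * l) * (fact (6 * n - 1) / fact (6 * n - 6 * l)) * c (6 * n - 6 * l))"
    by (subst sum.reindex) (auto simp: inj_on_def)
  finally have *: "c (6 * n) * 72 ^ n =
      (\<Sum>l = 1..n. ?f (6 * l) * (fact (6 * n - 1) / fact (6 * n - 6 * l)) * c (6 * n - 6 * l) * 72 ^ n)"
    by (simp add: sum_distrib_right)
  also have "\<dots> = (\<Sum>l = 1..n. fact (6 * n - 1) * (?f (6 * l) * 72 ^ l * weight (n - l)))"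
  proof (rule sum.cong)
    fix l assume l: "l \<in> {1..n}"
    have p: "(72::real) ^ n = 72 ^ l * 72 ^ (n - l)" using l by (simp flip: power_add)
    have q: "c (6 * n - 6 * l) * 72 ^ (n - l) = fact (6 * n - 6 * l) * weight (n - l)"
      using c6[of "n - l"] by (simp add: right_diff_distrib')
    have "c (6 * n - 6 * l) * 72 ^ n = 72 ^ l * (c (6 * n - 6 * l) * 72 ^ (n - l))"
      unfolding p by (rule mult.left_commute)
    then have "c (6 * n - 6 * l) * 72 ^ n = 72 ^ l * (fact (6 * n - 6 * l) * weight (n - l))"
      unfolding q by simp
    then have "?f (6 * l) * (fact (6 * n - 1) / fact (6 * n - 6 * l)) * (c (6 * n - 6 * l) * 72 ^ n) =
        fact (6 * n - 1) * (?f (6 * l) * 72 ^ l * weight (n - l))"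
      by simp
    then show "?f (6 * l) * (fact (6 * n - 1) / fact (6 * n - 6 * l)) * c (6 * n - 6 * l) * 72 ^ n =
        fact (6 * n - 1) * (?f (6 * l) * 72 ^ l * weight (n - l))"
      by (simp only: mult.assoc)
  qed simp
  also have "\<dots> = fact (6 * n - 1) * (\<Sum>l = 1..n. ?f (6 * l) * 72 ^ l * weight (n - l))"
    by (simp add: sum_distrib_left)
  finally have "fact (6 * n) * real (weight n) = fact (6 * n - 1) * (\<Sum>l = 1..n. ?f (6 * l) * 72 ^ l * weight (n - l))"
    by (simp only: c6 of_nat_mult of_nat_fact)
  moreover have "fact (6 * n) = real (6 * n) * fact (6 * n - 1)"
    using assms by (intro fact_reduce) simp
  ultimately have "fact (6 * n - 1) * (real (6 * n) * real (weight n)) =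
      fact (6 * n - 1) * (\<Sum>l = 1..n. ?f (6 * l) * 72 ^ l * weight (n - l))"
    by (simp only: ac_simps)
  then have "real (6 * n) * real (weight n) = (\<Sum>l = 1..n. ?f (6 * l) * 72 ^ l * weight (n - l))"
    by simp
  then have "real (6 * n * weight n) =
      real (\<Sum>l = 1..n. card (torsion_free_subgroups (6 * l)) * 72 ^ l * weight (n - l))"
    by simp
  then show ?thesis by (simp only: of_nat_eq_iff)
qed

end

section \<open>The weights modulo powers of 11\<close>

text \<open>The six new factors of (6n+6)! are divided by those of (3n+3)! and (2n+2)!. Here
  \<open>K\<close> is the product of the latter with n + 1 split off from 2n + 2, and 6n+6, 6n+4,
  6n+3, 6n+2 multiply to 12 K. The factor 6n + 5 that stays is the source of the prime 11.\<close>

lemma weight_Suc: "Suc n * weight (Suc n) = 12 * (6 * n + 5) * (6 * n + 1) * weight n"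
proof -
  define K where "K = (3 * n + 3) * (3 * n + 2) * (3 * n + 1) * (2 * n + 1) * 2"
  have f2: "fact (2 * Suc n) = (2 * n + 2) * ((2 * n + 1) * fact (2 * n))"
  proof -
    have "2 * Suc n = Suc (Suc (2 * n))" by simp
    then have "fact (2 * Suc n) = Suc (Suc (2 * n)) * (Suc (2 * n) * fact (2 * n))"
      by (simp only: fact_Suc of_nat_id)
    moreover have "Suc (Suc (2 * n)) = 2 * n + 2" "Suc (2 * n) = 2 * n + 1"
      by simp_all
    ultimately show ?thesis by metis
  qed
  have f3: "fact (3 * Suc n) = (3 * n + 3) * ((3 * n + 2) * ((3 * n + 1) * fact (3 * n)))"
  proof -
    have "3 * Suc n = Suc (Suc (Suc (3 * n)))" by simp
    then have "fact (3 * Suc n) = Suc (Suc (Suc (3 * n))) * (Suc (Suc (3 * n)) * (Suc (3 * n) * fact (3 * n)))"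
      by (simp only: fact_Suc of_nat_id)
    moreover have "Suc (Suc (Suc (3 * n))) = 3 * n + 3" "Suc (Suc (3 * n)) = 3 * n + 2" "Suc (3 * n) = 3 * n + 1"
      by simp_all
    ultimately show ?thesis by metis
  qed
  have f6: "fact (6 * Suc n) = (6 * n + 6) * ((6 * n + 5) * ((6 * n + 4) * ((6 * n + 3) * ((6 * n + 2) * ((6 * n + 1) * fact (6 * n))))))"
  proof -
    have "6 * Suc n = Suc (Suc (Suc (Suc (Suc (Suc (6 * n))))))" by simp
    then have "fact (6 * Suc n) = Suc (Suc (Suc (Suc (Suc (Suc (6 * n)))))) * (Suc (Suc (Suc (Suc (Suc (6 * n))))) * (Suc (Suc (Suc (Suc (6 * n)))) * (Suc (Suc (Suc (6 * n))) * (Suc (Suc (6 * n)) * (Suc (6 * n) * fact (6 * n))))))"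
      by (simp only: fact_Suc of_nat_id)
    moreover have "Suc (Suc (Suc (Suc (Suc (Suc (6 * n)))))) = 6 * n + 6" "Suc (Suc (Suc (Suc (Suc (6 * n))))) = 6 * n + 5" "Suc (Suc (Suc (Suc (6 * n)))) = 6 * n + 4" "Suc (Suc (Suc (6 * n))) = 6 * n + 3" "Suc (Suc (6 * n)) = 6 * n + 2" "Suc (6 * n) = 6 * n + 1"
      by simp_all
    ultimately show ?thesis by metis
  qed
  have a: "weight (Suc n) * (fact (3 * Suc n) * fact (2 * Suc n)) =
      K * (Suc n * weight (Suc n)) * (fact (3 * n) * fact (2 * n))"
  proof -
    have *: "W * ((3 * n + 3) * ((3 * n + 2) * ((3 * n + 1) * A)) * ((2 * n + 2) * ((2 * n + 1) * B))) =
        (3 * n + 3) * (3 * n + 2) * (3 * n + 1) * (2 * n + 1) * 2 * (Suc n * W) * (A * B)" for W A B :: nat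
      unfolding Suc_eq_plus1 by algebra
    show ?thesis unfolding f3 f2 K_def by (rule *)
  qed
  have b: "weight (Suc n) * (fact (3 * Suc n) * fact (2 * Suc n)) = fact (6 * Suc n)"
    by (rule weight_fact)
  have c: "fact (6 * Suc n) = (6 * n + 6) * (6 * n + 5) * (6 * n + 4) * (6 * n + 3) * (6 * n + 2) * (6 * n + 1)
      * (weight n * (fact (3 * n) * fact (2 * n)))"
    unfolding weight_fact f6 by (simp only: mult.assoc)
  have d: "(6 * n + 6) * (6 * n + 5) * (6 * n + 4) * (6 * n + 3) * (6 * n + 2) * (6 * n + 1) =
      K * (12 * (6 * n + 5) * (6 * n + 1))"
    unfolding K_def by algebra
  have "K * (Suc n * weight (Suc n)) * (fact (3 * n) * fact (2 * n)) =
      K * (12 * (6 * n + 5) * (6 * n + 1)) * (weight n * (fact (3 * n) * fact (2 * n)))"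
    using a[symmetric] b c unfolding d by simp
  also have "\<dots> = K * (12 * (6 * n + 5) * (6 * n + 1) * weight n) * (fact (3 * n) * fact (2 * n))"
    by (simp only: mult.assoc)
  finally have "K * (Suc n * weight (Suc n)) * (fact (3 * n) * fact (2 * n)) =
      K * (12 * (6 * n + 5) * (6 * n + 1) * weight n) * (fact (3 * n) * fact (2 * n))" .
  moreover have "K > 0" by (simp add: K_def)
  ultimately show ?thesis by simp
qed

lemma weight_0: "weight 0 = 1"
  by (simp add: weight_def)

lemma weight_dvd:
  assumes "n \<ge> 11 * a"
  shows "11 ^ a dvd weight n"
proof -
  have "11 ^ a dvd (fact (11 * a) :: nat)"
  proof (induction a)
    case (Suc a)
    have "fact (11 * a) dvd (fact (11 * a + 10) :: nat)" by (rule fact_dvd) simp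
    then have "11 ^ a dvd (fact (11 * a + 10) :: nat)" using Suc.IH dvd_trans by blast
    moreover have "(fact (11 * Suc a) :: nat) = (11 * a + 11) * fact (11 * a + 10)"
      using fact_reduce[of "11 * Suc a", where 'a = nat] by (simp add: add.commute)
    moreover have "11 dvd 11 * a + 11" by simp
    ultimately show ?case by (simp only: mult_dvd_mono power_Suc)
  qed simp
  also have "fact (11 * a) dvd (fact n :: nat)" using assms by (rule fact_dvd)
  finally show ?thesis unfolding weight_def by (rule dvd_mult)
qed

lemma prime_11: "prime (11::nat)"
  by (rule prime_nat_numeral_eq[THEN iffD2]) simp

text \<open>The step from 1 to 2 brings in 6 + 5 = 11. Up to n = 10 the divisors
  \<open>Suc n\<close> are prime to 11 and cannot remove it; from 11 on, n! is divisible by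
  11.\<close>

lemma weight_dvd_11:
  assumes "n \<ge> 2"
  shows "11 dvd weight n"
proof (cases "n \<ge> 11")
  case True
  then show ?thesis using weight_dvd[of 1 n] by simp
next
  case False
  have "n \<le> 10 \<Longrightarrow> 11 dvd weight n" using assms
  proof (induction n rule: dec_induct)
    case base
    have "2 * weight 2 = 12 * 11 * 7 * weight 1" using weight_Suc[of 1] by (simp add: numeral_2_eq_2)
    then have "11 dvd 2 * weight 2" by (metis dvd_mult dvd_mult2 dvd_refl)
    then show ?case using prime_dvd_mult_nat[OF prime_11] by auto
  next
    case (step n)
    then have "11 dvd Suc n * weight (Suc n)" unfolding weight_Suc by simp
    moreover have "\<not> 11 dvd Suc n" using step by (auto dest: dvd_imp_le)
    ultimately show ?case using prime_dvd_mult_nat[OF prime_11] by blast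
  qed
  then show ?thesis using False by simp
qed

text \<open>Here 79 is the inverse of 72 modulo 121.\<close>

fun weight_step :: "nat \<times> nat \<times> nat \<times> nat \<Rightarrow> nat \<times> nat \<times> nat \<times> nat" where
  "weight_step (n, w, p, t) = (Suc n, 12 * (6 * n + 5) * (6 * n + 1) * w div Suc n, 79 * p, w * p + t)"

lemma weight_step_funpow:
  "(weight_step ^^ k) (0, 1, 1, 0) = (k, weight k, 79 ^ k, \<Sum>n<k. weight n * 79 ^ n)"
proof (induction k)
  case (Suc k)
  have "12 * (6 * k + 5) * (6 * k + 1) * weight k div Suc k = weight (Suc k)"
    unfolding weight_Suc[symmetric] by (rule nonzero_mult_div_cancel_left) simp
  with Suc show ?case by simp
qed (simp add: weight_0)

text \<open>This evaluates H(1) modulo 121: the weights from index 22 on are divisible by 121. The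
  value 66 = 6 * 11 contains the prime 11 exactly once.\<close>

lemma weight_sum_121: "(\<Sum>n<22. weight n * 79 ^ n) mod 121 = 66"
proof -
  have "(\<Sum>n<22. weight n * 79 ^ n) = snd (snd (snd ((weight_step ^^ 22) (0, 1, 1, 0))))"
    unfolding weight_step_funpow by simp
  also have "\<dots> mod 121 = 66"
  proof -
    have "(weight_step ^^ k) x = (weight_step ^^ (k - 1)) (weight_step x)" if "k > 0" for k x
      using that by (cases k) (simp_all add: funpow_swap1)
    then show ?thesis by (simp flip: numeral_2_eq_2)
  qed
  finally show ?thesis .
qed

section \<open>The generating function modulo powers of 11\<close>

interpretation PSL2Z: modular_generators PSL2Z "proj mS" "proj mU"
  by (rule modular_generators_PSL2Z)

lemma num_free_subgroups_eq: "num_free_subgroups l = card (PSL2Z.torsion_free_subgroups (6 * l))"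
  by (simp add: num_free_subgroups_def PSL2Z.free_subgroups_of_index_eq PSL2Z.torsion_free_subgroups_def)

lemma num_free_subgroups_rec:
  assumes "n > 0"
  shows "6 * n * weight n = (\<Sum>l = 1..n. num_free_subgroups l * 72 ^ l * weight (n - l))"
  unfolding num_free_subgroups_eq using assms by (rule PSL2Z.weight_rec)

section \<open>Power series that reduce to polynomials modulo M\<close>

definition eventually_dvd :: "int \<Rightarrow> int fps \<Rightarrow> bool" where
  "eventually_dvd M A \<longleftrightarrow> (\<exists>N. \<forall>n\<ge>N. M dvd fps_nth A n)"

lemma eventually_dvd_add:
  assumes "eventually_dvd M A" "eventually_dvd M B"
  shows "eventually_dvd M (A + B)"
proof -
  obtain N1 N2 where "\<forall>n\<ge>N1. M dvd fps_nth A n" "\<forall>n\<ge>N2. M dvd fps_nth B n"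
    using assms unfolding eventually_dvd_def by auto
  then have "\<forall>n\<ge>max N1 N2. M dvd fps_nth (A + B) n" by simp
  then show ?thesis unfolding eventually_dvd_def by blast
qed

lemma eventually_dvd_sum:
  "(\<And>i. i \<in> I \<Longrightarrow> eventually_dvd M (A i)) \<Longrightarrow> eventually_dvd M (sum A I)"
  by (induction I rule: infinite_finite_induct)
     (auto simp: eventually_dvd_add, auto simp: eventually_dvd_def)

lemma eventually_dvd_poly: "eventually_dvd M (fps_of_poly p)"
  unfolding eventually_dvd_def
  by (intro exI[of _ "Suc (degree p)"]) (simp add: coeff_eq_0)

lemma eventually_dvd_const_mult:
  "M dvd c \<Longrightarrow> eventually_dvd M (fps_const c * A)"
  unfolding eventually_dvd_def by simp

lemma eventually_dvd_fps_X_mult: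
  "eventually_dvd M A \<Longrightarrow> eventually_dvd M (fps_X * A)"
  unfolding eventually_dvd_def
proof (elim exE)
  fix N assume "\<forall>n\<ge>N. M dvd fps_nth A n"
  then show "\<exists>N. \<forall>n\<ge>N. M dvd fps_nth (fps_X * A) n"
    by (intro exI[of _ "Suc N"]) auto
qed

lemma eventually_dvd_poly_mult:
  assumes "eventually_dvd M A"
  shows "eventually_dvd M (fps_of_poly p * A)"
proof (induction p)
  case 0
  then show ?case by (simp add: eventually_dvd_def)
next
  case (pCons c p)
  have "eventually_dvd M (fps_const c * A)"
    using assms unfolding eventually_dvd_def by (auto intro: dvd_mult)
  moreover have "fps_of_poly (pCons c p) * A = fps_const c * A + fps_X * (fps_of_poly p * A)"
    by (simp add: fps_of_poly_pCons algebra_simps)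
  ultimately show ?case
    using pCons.IH by (metis eventually_dvd_add eventually_dvd_fps_X_mult)
qed

definition geo :: "int fps" where "geo = Abs_fps (\<lambda>_. 1)"

lemma geo_inverse: "(1 - fps_X) * geo = 1"
  by (rule fps_ext) (simp add: geo_def left_diff_distrib fps_X_mult_nth)

lemma geo_cancel: "(1 - fps_X) ^ n * geo ^ n = 1"
  unfolding power_mult_distrib[symmetric] geo_inverse by simp

lemma geo_cancel_le:
  assumes "n \<le> m"
  shows "(1 - fps_X) ^ n * geo ^ m = geo ^ (m - n)"
proof -
  have "geo ^ m = geo ^ n * geo ^ (m - n)" using assms by (simp flip: power_add)
  then show ?thesis using geo_cancel[of n] by (simp flip: mult.assoc)
qed

text \<open>The second argument 1 is the inverse of the constant coefficient. This identifies the
  denominator of the theorem with a power of the geometric series.\<close>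

lemma fps_right_inverse_eq_geo: "fps_right_inverse ((1 - fps_X) ^ n) 1 = geo ^ n"
proof -
  have "(1 - fps_X) ^ n * fps_right_inverse ((1 - fps_X) ^ n) (1 :: int) = 1"
    by (rule fps_right_inverse) (simp add: fps_power_zeroth)
  then have "geo ^ n * ((1 - fps_X) ^ n * fps_right_inverse ((1 - fps_X) ^ n) 1) = geo ^ n" by simp
  moreover have "geo ^ n * ((1 - fps_X) ^ n * R) = ((1 - fps_X) ^ n * geo ^ n) * R" for R :: "int fps"
    by (simp only: ac_simps)
  ultimately show ?thesis unfolding geo_cancel by simp
qed

lemma fps_of_poly_one_minus_X: "fps_of_poly [:1, - 1:] = (1 - fps_X :: int fps)"
  by (simp add: fps_of_poly_pCons fps_of_poly_uminus flip: fps_const_neg)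

text \<open>Division of \<open>p\<close> by 1 - z leaves the remainder p(1), so only p(1) / (1-z)
  survives up to a polynomial.\<close>

lemma eventually_dvd_poly_mult_geo:
  "eventually_dvd M (fps_of_poly p * geo - fps_const (poly p 1) * geo)"
proof -
  define q where "q = synthetic_div p 1"
  have "[:1, - 1:] * (- q) + [:poly p 1:] = p"
    using synthetic_div_correct'[of 1 p] by (simp add: q_def)
  then have *: "fps_of_poly p = (1 - fps_X) * fps_of_poly (- q) + fps_const (poly p 1)"
    by (metis fps_of_poly_add fps_of_poly_const fps_of_poly_mult fps_of_poly_one_minus_X)
  then have "fps_of_poly p * geo - fps_const (poly p 1) * geo = fps_of_poly (- q) * ((1 - fps_X) * geo)"
    unfolding * distrib_right add_diff_cancel_right' by (simp only: ac_simps)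
  then show ?thesis by (simp add: geo_inverse eventually_dvd_poly)
qed

lemma dvd_diffE:
  fixes m :: "'a :: comm_ring_1"
  assumes "m dvd a - b"
  obtains c where "a = b + m * c"
proof -
  from assms obtain c where "a - b = m * c" by (rule dvdE)
  then have "a = b + m * c" by (simp add: diff_eq_eq add.commute)
  then show ?thesis by (rule that)
qed

lemma prime_11_int: "prime (11::int)"
  using prime_11 by (simp add: prime_int_numeral_eq)

text \<open>Let 11^v be the exact power of 11 in j and q = 11^e. From j C(q, j) = q C(q-1, j-1) it
  follows that 11^e divides 11^v C(q, j). The loss is small: v + 2 \<le> i holds by 2 \<le> i if v =
  0, and by v + 2 \<le> 11^v \<le> j \<le> i otherwise.\<close>

lemma dvd_binomial_prime_power:
  assumes "2 \<le> i" "1 \<le> j" "j \<le> i"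
  shows "11 ^ (e + 2) dvd 11 ^ i * ((11 ^ e) choose j :: nat)"
proof -
  obtain v m where m: "j = m * 11 ^ v" "\<not> 11 dvd m"
    using prime_power_canonical[OF prime_11, of j] assms(2) by auto
  have "j * ((11 ^ e) choose j) = 11 ^ e * ((11 ^ e - 1) choose (j - 1))"
    using times_binomial_minus1_eq[of j "11 ^ e"] assms(2) by simp
  then have "11 ^ e dvd m * (11 ^ v * ((11 ^ e) choose j))"
    by (metis dvd_triv_left m(1) mult.assoc)
  moreover have "coprime (11 ^ e) m"
    using m(2) prime_11 by (simp add: prime_imp_coprime)
  ultimately have *: "11 ^ e dvd 11 ^ v * ((11 ^ e) choose j)"
    by (simp add: coprime_dvd_mult_right_iff)
  have "v + 2 \<le> i"
  proof (cases "v = 0")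
    case False
    have "m > 0" using m assms(2) by (cases m) auto
    then have "11 ^ v \<le> i" using m(1) assms(3) by (metis Suc_leI dual_order.trans mult.commute mult_le_mono2 nat_mult_1_right One_nat_def)
    moreover have "v + 2 \<le> 11 ^ v" using False
    proof (induction v)
      case (Suc v)
      then show ?case by (cases "v = 0") auto
    qed simp
    ultimately show ?thesis by linarith
  qed (use assms in simp)
  have "11 ^ (e + 2) dvd (11 ^ 2 * (11 ^ v * ((11 ^ e) choose j)) :: nat)"
    using * by (simp only: power_add mult.commute[of "11 ^ e"]) (rule mult_dvd_mono, simp_all)
  also have "(11 ^ 2 * (11 ^ v * ((11 ^ e) choose j)) :: nat) = 11 ^ (v + 2) * ((11 ^ e) choose j)"
    by (simp only: power_add ac_simps)
  also have "\<dots> dvd 11 ^ i * ((11 ^ e) choose j)"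
    using \<open>v + 2 \<le> i\<close> by (intro mult_dvd_mono le_imp_power_dvd) simp_all
  finally show ?thesis .
qed

text \<open>Expand 1 - z^q in powers (1-z)^j with j \<ge> 1, where q = 11^e. For j > i the pole is
  cancelled and a polynomial remains, which disposes of i = 0. For j \<le> i and i \<ge> 2 the
  coefficient is 0 modulo 11^(e+2). Only i = j = 1 is left, with 11 q / (1-z).\<close>

lemma shift_pole:
  "eventually_dvd (11 ^ (e + 2)) (fps_const (11 ^ i) * ((1 - fps_X ^ 11 ^ e) * geo ^ (i + 1)) -
     (if i = 1 then fps_const (11 ^ (e + 1)) * geo else 0))"
proof -
  let ?q = "11 ^ e :: nat" and ?Y = "1 - fps_X :: int fps" and ?M = "11 ^ (e + 2) :: int"
  let ?T = "\<lambda>j. fps_const (- ((- 1) ^ j) * int (?q choose j)) * ?Y ^ j"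
  have "fps_X ^ ?q = (1 + (- ?Y)) ^ ?q" by simp
  also have "\<dots> = (\<Sum>j\<le>?q. of_nat (?q choose j) * (- ?Y) ^ j)"
    using binomial_ring[of "- ?Y" 1 ?q] by (simp add: add.commute)
  also have "\<dots> = (\<Sum>j\<le>?q. - ?T j)"
  proof (rule sum.cong)
    fix j
    have "(- ?Y) ^ j = fps_const ((- 1) ^ j) * ?Y ^ j"
      by (subst power_minus) (simp flip: fps_const_power fps_const_neg)
    then show "of_nat (?q choose j) * (- ?Y) ^ j = - ?T j"
      by (simp add: fps_of_nat[symmetric] flip: fps_const_neg fps_const_mult)
  qed simp
  also have "\<dots> = 1 - (\<Sum>j=1..?q. ?T j)"
    by (simp add: atMost_atLeast0 sum.atLeast_Suc_atMost sum_negf)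
  finally have X: "1 - fps_X ^ ?q = (\<Sum>j=1..?q. ?T j)" by simp
  have summand: "eventually_dvd ?M (fps_const (11 ^ i) * (?T j * geo ^ (i + 1)) -
      (if i = 1 \<and> j = 1 then fps_const (11 ^ (e + 1)) * geo else 0))" if j: "j \<ge> 1" for j
  proof -
    let ?c = "- ((- 1) ^ j) * int (?q choose j)"
    have eq: "fps_const (11 ^ i) * (?T j * geo ^ (i + 1)) = fps_const (11 ^ i * ?c) * (?Y ^ j * geo ^ (i + 1))"
      by (simp only: fps_const_mult[symmetric] mult.assoc)
    consider "j \<ge> i + 1" | "i = 1" "j = 1" | "j \<le> i" "i \<ge> 2" using j by (cases "j \<le> i"; cases "i \<ge> 2") auto
    then show ?thesis
    proof cases
      case 1
      then have "?Y ^ j = ?Y ^ (j - (i + 1)) * ?Y ^ (i + 1)"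
        by (metis le_add_diff_inverse2 power_add)
      then have "?Y ^ j * geo ^ (i + 1) = fps_of_poly ([:1, - 1:] ^ (j - (i + 1)))"
        using geo_cancel[of "i + 1"] by (simp only: fps_of_poly_power fps_of_poly_one_minus_X mult.assoc mult_1_right)
      then have *: "fps_const (11 ^ i * ?c) * (?Y ^ j * geo ^ (i + 1)) =
          fps_of_poly (smult (11 ^ i * ?c) ([:1, - 1:] ^ (j - (i + 1))))"
        by (simp only: fps_of_poly_smult)
      have nij: "\<not> (i = 1 \<and> j = 1)" using 1 by auto
      show ?thesis unfolding eq * by (simp only: nij if_False diff_zero eventually_dvd_poly)
    next
      case 2
      have "?Y ^ 1 * geo ^ (1 + 1) = geo" using geo_inverse by (simp add: mult.assoc[symmetric])
      then have *: "fps_const (11 ^ i) * (?T j * geo ^ (i + 1)) = fps_const (11 ^ (e + 1)) * geo"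
        unfolding eq using 2 by simp
      have ij: "(if i = 1 \<and> j = 1 then fps_const (11 ^ (e + 1)) * geo else 0) = fps_const (11 ^ (e + 1)) * geo"
        using 2 by simp
      show ?thesis unfolding * ij by (simp add: eventually_dvd_def)
    next
      case 3
      have "int (11 ^ (e + 2)) dvd int (11 ^ i * (?q choose j))"
        using dvd_binomial_prime_power[OF 3(2) j 3(1)] by (simp only: of_nat_dvd_iff)
      then have "?M dvd 11 ^ i * int (?q choose j)" by simp
      then have "?M dvd 11 ^ i * ?c" by (metis dvd_mult dvd_mult2 mult.assoc mult.left_commute)
      then have "eventually_dvd ?M (fps_const (11 ^ i * ?c) * (?Y ^ j * geo ^ (i + 1)))"
        by (rule eventually_dvd_const_mult)
      moreover have nij: "\<not> (i = 1 \<and> j = 1)" using 3 by auto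
      ultimately show ?thesis unfolding eq by (simp only: nij if_False diff_zero)
    qed
  qed
  have "fps_const (11 ^ i) * ((1 - fps_X ^ ?q) * geo ^ (i + 1)) - (if i = 1 then fps_const (11 ^ (e + 1)) * geo else 0) =
      (\<Sum>j=1..?q. fps_const (11 ^ i) * (?T j * geo ^ (i + 1)) -
        (if i = 1 \<and> j = 1 then fps_const (11 ^ (e + 1)) * geo else 0))"
  proof -
    have "(\<Sum>j=1..?q. if i = 1 \<and> j = 1 then fps_const (11 ^ (e + 1)) * geo else 0) =
        (if i = 1 then fps_const (11 ^ (e + 1)) * geo else 0)"
      by (cases "i = 1") (simp_all add: sum.delta)
    then show ?thesis unfolding X by (simp only: sum_subtractf sum_distrib_left sum_distrib_right)
  qed
  then show ?thesis using summand by (auto intro: eventually_dvd_sum)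
qed

definition free_gf :: "int fps" where
  "free_gf = Abs_fps (\<lambda>l. if l \<ge> 1 then int (num_free_subgroups l) else 0)"

text \<open>Put W = -11 G / (1-z), so that H / (1-z) = 1 - W modulo 11^a. As W^a is divisible by
  11^a, the sum of W^i over i < a inverts 1 - W modulo 11^a, and expanding that sum gives the
  poles.\<close>

lemma free_gf_expansion:
  assumes a: "a \<ge> 1"
  obtains A :: "nat \<Rightarrow> int poly" where
    "(11 :: int fps) ^ a dvd free_gf - (\<Sum>i<a. 11 ^ i * (fps_of_poly (A i) * geo ^ (i + 1)))"
    "a \<ge> 2 \<Longrightarrow> \<not> 11 dvd poly (A 1) 1"
proof -
  let ?M = "11 ^ a :: int" and ?F = "11 ^ a :: int fps"
  have F: "?F = fps_const ?M" by (simp add: numeral_fps_const)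
  have dvdI: "?F dvd B" if "\<And>n. ?M dvd fps_nth B n" for B :: "int fps"
  proof
    show "B = ?F * Abs_fps (\<lambda>n. fps_nth B n div ?M)"
      unfolding F using that by (intro fps_ext) simp
  qed
  \<comment> \<open>\<open>u\<close> plays the role of 1/72, so that \<open>h n\<close> is an
    integer standing for h_n modulo 11^a.\<close>
  obtain u where u: "[72 * u = 1] (mod ?M)"
  proof -
    have "coprime (72 :: int) 11" by (simp add: coprime_iff_gcd_eq_1 gcd_non_0_int)
    then show ?thesis using cong_solve_coprime_int[of 72 ?M] that by auto
  qed
  define h where "h n = int (weight n) * u ^ n" for n
  have h_big: "?M dvd h n" if "n \<ge> 11 * a" for n
  proof -
    have "int (11 ^ a) dvd int (weight n)" using weight_dvd[OF that] by (simp only: of_nat_dvd_iff)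
    then show ?thesis by (simp add: h_def)
  qed
  have u11: "[72 * u = 1] (mod 11)"
    by (rule cong_dvd_modulus[OF u]) (use a in \<open>simp add: dvd_power\<close>)
  \<comment> \<open>The truncation at \<open>11 * a\<close> is harmless modulo 11^a by
    \<open>h_big\<close>.\<close>
  define Hp where "Hp = (\<Sum>n<11 * a. monom (h n) n)"
  have coeff_Hp: "coeff Hp n = (if n < 11 * a then h n else 0)" for n
    by (simp add: Hp_def coeff_sum)
  have h0: "h 0 = 1" by (simp add: h_def weight_0)
  have h1: "11 dvd h 1 + 1"
  proof -
    have "weight 1 = 60" using weight_Suc[of 0] by (simp add: weight_0)
    \<comment> \<open>\<open>h 1 + 1\<close> is 60 u + 1, rearranged so that the defining congruence
      of \<open>u\<close> applies: 60 + 72 = 132 = 11 * 12.\<close>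
    then have *: "h 1 + 1 = 11 * (12 * u) + (1 - 72 * u)" by (simp add: h_def)
    have "11 dvd 1 - 72 * u" using u11 by (simp add: cong_iff_dvd_diff dvd_diff_commute)
    then show ?thesis unfolding * by (intro dvd_add dvd_triv_left)
  qed
  have h2: "11 dvd h n" if "n \<ge> 2" for n
  proof -
    have "int 11 dvd int (weight n)" using weight_dvd_11[OF that] by (simp only: of_nat_dvd_iff)
    then show ?thesis by (simp add: h_def)
  qed
  have "[:11:] dvd Hp - [:1, - 1:]"
  proof (rule const_poly_dvd_iff[THEN iffD2], rule allI)
    fix n :: nat
    consider "n = 0" | "n = 1" | "n \<ge> 2" by linarith
    then show "11 dvd coeff (Hp - [:1, - 1:]) n"
    proof cases
      case 3
      then have "coeff [:1, - 1 :: int:] n = 0" by (simp add: coeff_pCons split: nat.split)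
      then show ?thesis using 3 h2 by (simp add: coeff_Hp)
    qed (use a h0 h1 in \<open>simp_all add: coeff_Hp\<close>)
  qed
  then obtain g where g: "Hp = [:1, - 1:] + [:11:] * g"
    by (rule dvd_diffE)
  define P where "P = fps_of_poly Hp"
  define W where "W = - (11 * (fps_of_poly g * geo))"
  have PV: "P * geo = 1 - W"
    unfolding P_def W_def g fps_of_poly_add fps_of_poly_mult fps_of_poly_one_minus_X
    by (simp add: distrib_right geo_inverse mult.assoc)
  define H where "H = Abs_fps h"
  have HP: "?F dvd H - P"
    using h_big by (intro dvdI) (simp add: H_def P_def coeff_Hp)
  have rec: "?F dvd free_gf * H - 6 * (fps_X * fps_deriv H)"
  proof (rule dvdI)
    fix n
    show "?M dvd fps_nth (free_gf * H - 6 * (fps_X * fps_deriv H)) n"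
    proof (cases "n = 0")
      case True
      then show ?thesis by (simp add: free_gf_def)
    next
      case False
      have "fps_nth (free_gf * H) n = (\<Sum>l=0..n. fps_nth free_gf l * h (n - l))"
        by (simp add: fps_mult_nth H_def)
      also have "\<dots> = (\<Sum>l=1..n. int (num_free_subgroups l) * h (n - l))"
        by (simp add: sum.atLeast_Suc_atMost free_gf_def)
      finally have 1: "fps_nth (free_gf * H) n = (\<Sum>l=1..n. int (num_free_subgroups l) * h (n - l))" .
      have "[(\<Sum>l=1..n. int (num_free_subgroups l) * h (n - l)) =
          (\<Sum>l=1..n. u ^ n * int (num_free_subgroups l * 72 ^ l * weight (n - l)))] (mod ?M)"
      proof (rule cong_sum)
        fix l assume l: "l \<in> {1..n}"
        \<comment> \<open>Inserting this power of 1 turns \<open>u ^ (n - l)\<close> into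
          \<open>u ^ n * 72 ^ l\<close>, so the recurrence for the weights applies after
          \<open>u ^ n\<close> is taken out.\<close>
        have "[1 = (72 * u) ^ l] (mod ?M)" using cong_pow[OF u, of l] by (simp add: cong_sym_eq)
        then have "[int (num_free_subgroups l) * h (n - l) * 1 = int (num_free_subgroups l) * h (n - l) * (72 * u) ^ l] (mod ?M)"
          by (rule cong_scalar_left)
        moreover have "u ^ n = u ^ l * u ^ (n - l)" using l by (simp flip: power_add)
        ultimately show "[int (num_free_subgroups l) * h (n - l) =
            u ^ n * int (num_free_subgroups l * 72 ^ l * weight (n - l))] (mod ?M)"
          by (simp add: h_def power_mult_distrib ac_simps)
      qed
      also have "(\<Sum>l=1..n. u ^ n * int (num_free_subgroups l * 72 ^ l * weight (n - l))) =
          u ^ n * int (6 * n * weight n)"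
        using num_free_subgroups_rec[of n] False by (simp add: sum_distrib_left)
      also have "\<dots> = fps_nth (6 * (fps_X * fps_deriv H)) n"
        using False by (simp add: H_def h_def numeral_fps_const del: fps_const_mult)
      finally show ?thesis unfolding fps_sub_nth 1 by (simp add: cong_iff_dvd_diff)
    qed
  qed
  have "?F dvd free_gf * P - 6 * (fps_X * fps_deriv P)"
  proof -
    obtain C where C: "H = P + ?F * C" using HP by (rule dvd_diffE)
    have "fps_deriv H = fps_deriv P + ?F * fps_deriv C" unfolding C F by simp
    then have "free_gf * P - 6 * (fps_X * fps_deriv P) =
        (free_gf * H - 6 * (fps_X * fps_deriv H)) - ?F * (free_gf * C - 6 * (fps_X * fps_deriv C))"
      by (simp add: C algebra_simps)
    then show ?thesis using rec by (metis dvd_diff dvd_triv_left)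
  qed
  \<comment> \<open>The factor is the inverse of P modulo 11^a; by the telescoping of (1 - W) times
    the partial geometric sum it isolates \<open>free_gf\<close>.\<close>
  then have "?F dvd (free_gf * P - 6 * (fps_X * fps_deriv P)) * (geo * (\<Sum>i<a. W ^ i))"
    by (rule dvd_mult2)
  also have "(free_gf * P - 6 * (fps_X * fps_deriv P)) * (geo * (\<Sum>i<a. W ^ i)) =
      free_gf * ((P * geo) * (\<Sum>i<a. W ^ i)) - 6 * (fps_X * fps_deriv P) * geo * (\<Sum>i<a. W ^ i)"
    by (simp only: algebra_simps)
  also have "(P * geo) * (\<Sum>i<a. W ^ i) = 1 - W ^ a"
    unfolding PV by (rule one_diff_power_eq[symmetric])
  finally have "?F dvd (free_gf * (1 - W ^ a) - 6 * (fps_X * fps_deriv P) * geo * (\<Sum>i<a. W ^ i)) + free_gf * W ^ a"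
  proof (rule dvd_add)
    have "W ^ a = ?F * (- (fps_of_poly g * geo)) ^ a"
      unfolding W_def by (simp flip: power_mult_distrib)
    then show "?F dvd free_gf * W ^ a" by simp
  qed
  also have "(free_gf * (1 - W ^ a) - 6 * (fps_X * fps_deriv P) * geo * (\<Sum>i<a. W ^ i)) + free_gf * W ^ a =
      free_gf - 6 * (fps_X * fps_deriv P) * geo * (\<Sum>i<a. W ^ i)"
    by (simp add: algebra_simps)
  finally have main: "?F dvd free_gf - 6 * (fps_X * fps_deriv P) * geo * (\<Sum>i<a. W ^ i)" .
  define A where "A i = [:0, 6:] * pderiv Hp * (- g) ^ i" for i
  have A: "fps_of_poly (A i) = 6 * fps_X * fps_deriv P * (- fps_of_poly g) ^ i" for i
    by (simp add: A_def P_def fps_of_poly_mult fps_of_poly_power fps_of_poly_uminus fps_of_poly_pderiv fps_of_poly_pCons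
        fps_of_poly_smult numeral_fps_const mult.assoc)
  have "6 * (fps_X * fps_deriv P) * geo * (\<Sum>i<a. W ^ i) =
      (\<Sum>i<a. 11 ^ i * (fps_of_poly (A i) * geo ^ (i + 1)))"
    unfolding sum_distrib_left
  proof (rule sum.cong)
    fix i
    have "W ^ i = 11 ^ i * ((- fps_of_poly g) ^ i * geo ^ i)"
      unfolding W_def by (simp flip: power_mult_distrib)
    then show "6 * (fps_X * fps_deriv P) * geo * W ^ i = 11 ^ i * (fps_of_poly (A i) * geo ^ (i + 1))"
      unfolding A by (simp add: ac_simps)
  qed simp
  with main have "?F dvd free_gf - (\<Sum>i<a. 11 ^ i * (fps_of_poly (A i) * geo ^ (i + 1)))" by simp
  \<comment> \<open>A_1(1) is the product of 6, H'(1) and -G(1). Modulo 11 the derivative is -1, and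
    since 1 - z vanishes at 1, H(1) = 11 G(1); hence H(1) is needed modulo 121, which is available
    because a \<ge> 2.\<close>
  moreover have "\<not> 11 dvd poly (A 1) 1" if a2: "a \<ge> 2"
  proof -
    have "poly Hp 1 = (\<Sum>n<11 * a. h n)" by (simp add: Hp_def poly_sum poly_monom)
    also have "[(\<Sum>n<11 * a. h n) = (\<Sum>n<22. h n)] (mod 121)"
    proof -
      have "11 * a \<ge> 22" using a2 by simp
      then have "{..<11 * a} = {..<22} \<union> {22..<11 * a}" by auto
      then have "(\<Sum>n<11 * a. h n) = (\<Sum>n<22. h n) + (\<Sum>n=22..<11 * a. h n)"
        by (simp add: sum.union_disjoint ivl_disj_int)
      moreover have "121 dvd (\<Sum>n=22..<11 * a. h n)"
      proof (rule dvd_sum)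
        fix n assume "n \<in> {22..<11 * a}"
        then have "int (11 ^ 2) dvd int (weight n)" using weight_dvd[of 2 n] by (simp only: of_nat_dvd_iff) simp
        then show "121 dvd h n" by (simp add: h_def)
      qed
      ultimately show ?thesis by (simp add: cong_iff_dvd_diff)
    qed
    also have "[(\<Sum>n<22. h n) = (\<Sum>n<22. int (weight n * 79 ^ n))] (mod 121)"
    proof (rule cong_sum)
      fix n
      have "11 ^ 2 dvd ?M" by (rule le_imp_power_dvd[OF a2])
      then have "[72 * u = 72 * 79] (mod 121)"
        using cong_dvd_modulus[OF u, of 121] cong_def[of "72 * u" 1 "121::int"] by (simp add: cong_def)
      then have "[u = 79] (mod 121)" by (subst (asm) cong_mult_lcancel) (auto simp: coprime_iff_gcd_eq_1 gcd_non_0_int)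
      then show "[h n = int (weight n * 79 ^ n)] (mod 121)"
        unfolding h_def by (simp add: cong_scalar_left cong_pow)
    qed
    also have "(\<Sum>n<22. int (weight n * 79 ^ n)) = int (\<Sum>n<22. weight n * 79 ^ n)" by simp
    also have "[\<dots> = int 66] (mod 121)"
    proof -
      have "int (\<Sum>n<22. weight n * 79 ^ n) mod int 121 = int 66"
        using weight_sum_121 by (metis zmod_int)
      then show ?thesis by (simp only: cong_def of_nat_numeral) simp
    qed
    finally have "poly Hp 1 mod 121 = 66" by (simp add: cong_def)
    moreover have "poly Hp 1 = 11 * poly g 1" by (simp add: g)
    ultimately have "\<not> 11 dvd poly g 1" by presburger
    moreover have "poly (pderiv Hp) 1 = - 1 + 11 * poly (pderiv g) 1"
      by (simp add: g pderiv_smult pderiv_add pderiv_mult pderiv_pCons)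
    then have "\<not> 11 dvd poly (pderiv Hp) 1" by presburger
    moreover have "poly (A 1) 1 = 6 * poly (pderiv Hp) 1 * (- poly g 1)" by (simp add: A_def)
    moreover have "\<not> 11 dvd (6::int)" by simp
    ultimately show ?thesis using prime_dvd_mult_iff[OF prime_11_int] by (metis dvd_minus_iff)
  qed
  ultimately show ?thesis using that by blast
qed

text \<open>Apart from a polynomial, (1 - z^q) (F - 1) is 11^(e+1) A_1(1) / (1-z) modulo 11^(e+2),
  where q = 11^e. So late differences at distance q have exact 11-adic order e + 1. The
  \<open>c\<close> of the statement is -A_1(1).\<close>

lemma num_free_subgroups_shift:
  obtains c :: int and N where "\<not> 11 dvd c"
    "\<And>n. n \<ge> N \<Longrightarrow> 11 ^ (e + 2) dvd int (num_free_subgroups (n + 11 ^ e)) - int (num_free_subgroups n) + 11 ^ (e + 1) * c"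
proof -
  let ?q = "11 ^ e :: nat" and ?M = "11 ^ (e + 2) :: int"
  obtain A :: "nat \<Rightarrow> int poly" where
    A: "(11 :: int fps) ^ (e + 2) dvd free_gf - (\<Sum>i<e + 2. 11 ^ i * (fps_of_poly (A i) * geo ^ (i + 1)))"
    and A1: "\<not> 11 dvd poly (A 1) 1"
    using free_gf_expansion[of "e + 2"] by auto
  define c where "c = poly (A 1) 1"
  obtain C where C: "free_gf = (\<Sum>i<e + 2. 11 ^ i * (fps_of_poly (A i) * geo ^ (i + 1))) + 11 ^ (e + 2) * C"
    using A by (rule dvd_diffE)
  have c11: "(11 :: int fps) ^ k = fps_const (11 ^ k)" for k by (simp add: numeral_fps_const)
  let ?D = "\<lambda>i. fps_const (11 ^ i) * ((1 - fps_X ^ ?q) * geo ^ (i + 1)) -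
      (if i = 1 then fps_const (11 ^ (e + 1)) * geo else 0)"
  have eq: "(1 - fps_X ^ ?q) * free_gf - fps_const (11 ^ (e + 1) * c) * geo =
      (\<Sum>i<e + 2. fps_of_poly (A i) * ?D i) +
      fps_const (11 ^ (e + 1)) * (fps_of_poly (A 1) * geo - fps_const c * geo) +
      fps_const ?M * ((1 - fps_X ^ ?q) * C)"
  proof -
    have "(\<Sum>i<e + 2. fps_of_poly (A i) * (if i = 1 then fps_const (11 ^ (e + 1)) * geo else 0)) =
        fps_of_poly (A 1) * (fps_const (11 ^ (e + 1)) * geo)"
      by (simp add: if_distrib[of "\<lambda>x. _ * x"] sum.delta cong: if_cong)
    moreover have "(\<Sum>i<e + 2. fps_of_poly (A i) * (fps_const (11 ^ i) * ((1 - fps_X ^ ?q) * geo ^ (i + 1)))) =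
        (1 - fps_X ^ ?q) * (\<Sum>i<e + 2. 11 ^ i * (fps_of_poly (A i) * geo ^ (i + 1)))"
      unfolding sum_distrib_left c11 by (intro sum.cong refl) (simp only: ac_simps)
    moreover have "fps_const (11 ^ (e + 1) * c) = fps_const (11 ^ (e + 1)) * fps_const c" by simp
    ultimately show ?thesis
      unfolding C c11 right_diff_distrib sum_subtractf by (simp only: algebra_simps)
  qed
  have "eventually_dvd ?M (fps_const (11 ^ (e + 1)) * (fps_of_poly (A 1) * geo - fps_const c * geo))"
    using eventually_dvd_poly_mult[OF eventually_dvd_poly_mult_geo[of ?M "A 1"], of "[:11 ^ (e + 1):]"]
    unfolding c_def fps_of_poly_const .
  moreover have "eventually_dvd ?M (\<Sum>i<e + 2. fps_of_poly (A i) * ?D i)"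
    by (intro eventually_dvd_sum eventually_dvd_poly_mult shift_pole)
  moreover have "eventually_dvd ?M (fps_const ?M * ((1 - fps_X ^ ?q) * C))"
    by (rule eventually_dvd_const_mult) simp
  ultimately have "eventually_dvd ?M ((1 - fps_X ^ ?q) * free_gf - fps_const (11 ^ (e + 1) * c) * geo)"
    unfolding eq by (intro eventually_dvd_add)
  then obtain N where N: "?M dvd fps_nth ((1 - fps_X ^ ?q) * free_gf - fps_const (11 ^ (e + 1) * c) * geo) n" if "n \<ge> N" for n
    unfolding eventually_dvd_def by auto
  \<comment> \<open>The bound 1 keeps the index inside the range where the coefficients of
    \<open>free_gf\<close> are defined as \<open>num_free_subgroups\<close>.\<close>
  have "?M dvd int (num_free_subgroups (n + ?q)) - int (num_free_subgroups n) + 11 ^ (e + 1) * (- c)"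
    if "n \<ge> max 1 N" for n
    using N[of "n + ?q"] that by (simp add: left_diff_distrib fps_X_power_mult_nth free_gf_def geo_def)
  moreover have "\<not> 11 dvd - c" using A1 by (simp add: c_def)
  ultimately show ?thesis using that by blast
qed

section \<open>Eventual periods\<close>

lemma eventual_period_diff:
  assumes "eventual_period g p" "eventual_period g q" "p < q"
  shows "eventual_period g (q - p)"
proof -
  obtain N1 N2 where N: "\<forall>n\<ge>N1. g (n + p) = g n" "\<forall>n\<ge>N2. g (n + q) = g n"
    using assms unfolding eventual_period_def by auto
  have "g (n + (q - p)) = g n" if n: "n \<ge> max N1 N2" for n
  proof -
    have "g (n + (q - p)) = g (n + (q - p) + p)" using N(1) n by simp
    also have "\<dots> = g n" using N(2) n assms(3) by simp
    finally show ?thesis .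
  qed
  then show ?thesis using assms(3) unfolding eventual_period_def by (auto intro!: exI[of _ "max N1 N2"])
qed

lemma eventual_period_mult:
  assumes "eventual_period g p" "k > 0"
  shows "eventual_period g (k * p)"
proof -
  obtain N where N: "\<forall>n\<ge>N. g (n + p) = g n" using assms unfolding eventual_period_def by auto
  have "g (n + k * p) = g n" if "n \<ge> N" for n
  proof (induction k)
    case (Suc k)
    have "g (n + Suc k * p) = g ((n + k * p) + p)" by (simp add: algebra_simps)
    also have "\<dots> = g (n + k * p)" using N that by simp
    finally show ?case using Suc by simp
  qed simp
  then show ?thesis using assms unfolding eventual_period_def by auto
qed

text \<open>Differences of eventual periods are eventual periods, so the minimal one can be
  subtracted from \<open>q\<close> until \<open>q\<close> equals it.\<close>

lemma minimal_period_dvd: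
  assumes "eventual_period g q"
  shows "eventual_period g (minimal_period g) \<and> minimal_period g dvd q"
proof
  let ?p = "minimal_period g"
  show p: "eventual_period g ?p" unfolding minimal_period_def using assms by (rule LeastI)
  have le: "?p \<le> r" if "eventual_period g r" for r
    unfolding minimal_period_def using that by (rule Least_le)
  show "?p dvd q" using assms
  proof (induction q rule: less_induct)
    case (less q)
    show ?case
    proof (cases "q = ?p")
      case False
      then have lt: "?p < q" using le[OF less.prems] by simp
      have "?p > 0" using p unfolding eventual_period_def by simp
      then have "?p dvd q - ?p" using less.IH[OF _ eventual_period_diff[OF p less.prems lt]] lt by simp
      then show ?thesis by (rule dvd_diffD) (use lt in simp_all)
    qed simp
  qed
qed

theorem theorem14:
  fixes \<alpha> :: nat
  assumes "\<alpha> \<ge> 1"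
  shows "(\<exists>P :: int poly.
            fps_cong free_subgroup_gf
              (fps_of_poly P * fps_right_inverse ((1 - fps_X) ^ \<alpha>) 1) (11 ^ \<alpha>)) \<and>
         ultimately_periodic (\<lambda>l. num_free_subgroups (Suc l) mod 11 ^ \<alpha>) \<and>
         minimal_period (\<lambda>l. num_free_subgroups (Suc l) mod 11 ^ \<alpha>) = 11 ^ (\<alpha> - 1)"
proof (intro conjI)
  let ?g = "\<lambda>l. num_free_subgroups (Suc l) mod 11 ^ \<alpha>"
  obtain A :: "nat \<Rightarrow> int poly" where
    A: "(11 :: int fps) ^ \<alpha> dvd free_gf - (\<Sum>i<\<alpha>. 11 ^ i * (fps_of_poly (A i) * geo ^ (i + 1)))"
    using free_gf_expansion[OF assms] by blast
  \<comment> \<open>All poles are brought over the common denominator (1-z)^\<alpha>; the first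
    summand accounts for the constant term 1 of F.\<close>
  define P where "P = [:1, - 1:] ^ \<alpha> + (\<Sum>i<\<alpha>. 11 ^ i * (A i * [:1, - 1:] ^ (\<alpha> - (i + 1))))"
  have P: "fps_of_poly P * geo ^ \<alpha> = 1 + (\<Sum>i<\<alpha>. 11 ^ i * (fps_of_poly (A i) * geo ^ (i + 1)))"
  proof -
    have "(1 - fps_X) ^ (\<alpha> - (i + 1)) * geo ^ \<alpha> = geo ^ (i + 1)" if "i < \<alpha>" for i
      using geo_cancel_le[of "\<alpha> - (i + 1)" \<alpha>] that by simp
    then show ?thesis
      by (simp add: P_def fps_of_poly_add fps_of_poly_sum fps_of_poly_mult fps_of_poly_power
          fps_of_poly_one_minus_X distrib_right geo_cancel sum_distrib_right mult.assoc del: power_Suc)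
  qed
  have gf: "free_subgroup_gf = 1 + free_gf"
    by (simp add: free_subgroup_gf_def free_gf_def)
  have "(11 :: int fps) ^ \<alpha> dvd free_subgroup_gf - fps_of_poly P * fps_right_inverse ((1 - fps_X) ^ \<alpha>) 1"
    using A unfolding fps_right_inverse_eq_geo P gf by (simp only: add_diff_cancel_left)
  then obtain C where "free_subgroup_gf - fps_of_poly P * fps_right_inverse ((1 - fps_X) ^ \<alpha>) 1 = fps_const (11 ^ \<alpha>) * C"
    by (auto simp: numeral_fps_const)
  then have "fps_nth (free_subgroup_gf - fps_of_poly P * fps_right_inverse ((1 - fps_X) ^ \<alpha>) 1) n = 11 ^ \<alpha> * fps_nth C n" for n
    by simp
  then have "fps_cong free_subgroup_gf (fps_of_poly P * fps_right_inverse ((1 - fps_X) ^ \<alpha>) 1) (11 ^ \<alpha>)"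
    unfolding fps_cong_def cong_iff_dvd_diff by (metis dvd_triv_left fps_sub_nth)
  then show "\<exists>P :: int poly. fps_cong free_subgroup_gf
      (fps_of_poly P * fps_right_inverse ((1 - fps_X) ^ \<alpha>) 1) (11 ^ \<alpha>)" by blast

  have g_eq: "?g m = ?g n \<longleftrightarrow> 11 ^ \<alpha> dvd int (num_free_subgroups (Suc m)) - int (num_free_subgroups (Suc n))" for m n
  proof -
    have "?g m = ?g n \<longleftrightarrow> [int (num_free_subgroups (Suc m)) = int (num_free_subgroups (Suc n))] (mod int (11 ^ \<alpha>))"
      by (simp only: cong_int_iff) (simp add: cong_def)
    then show ?thesis by (simp add: cong_iff_dvd_diff)
  qed
  \<comment> \<open>Case e = \<alpha> - 1 of the shift congruence: the correction term is a multiple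
    of 11^\<alpha> and disappears.\<close>
  have per: "eventual_period ?g (11 ^ (\<alpha> - 1))"
  proof -
    obtain c N where N: "11 ^ (\<alpha> - 1 + 2) dvd
        int (num_free_subgroups (n + 11 ^ (\<alpha> - 1))) - int (num_free_subgroups n) + 11 ^ (\<alpha> - 1 + 1) * c"
      if "n \<ge> N" for n using num_free_subgroups_shift[of "\<alpha> - 1"] by metis
    have "?g (n + 11 ^ (\<alpha> - 1)) = ?g n" if "n \<ge> N" for n
    proof -
      have "11 ^ \<alpha> dvd (11 :: int) ^ (\<alpha> - 1 + 2)" by (rule le_imp_power_dvd) simp
      then have "11 ^ \<alpha> dvd int (num_free_subgroups (Suc n + 11 ^ (\<alpha> - 1))) - int (num_free_subgroups (Suc n)) + 11 ^ (\<alpha> - 1 + 1) * c"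
        using N[of "Suc n"] that dvd_trans by auto
      moreover have "(11 :: int) ^ \<alpha> dvd 11 ^ (\<alpha> - 1 + 1) * c" using assms by simp
      ultimately show ?thesis unfolding g_eq by (simp add: dvd_add_left_iff)
    qed
    then show ?thesis unfolding eventual_period_def by auto
  qed
  then show "ultimately_periodic ?g" unfolding ultimately_periodic_def by blast

  \<comment> \<open>Case e = \<alpha> - 2: the correction term is 11^(\<alpha> - 1) times a number
    prime to 11, which is nonzero modulo 11^\<alpha>.\<close>
  have not_per: "\<not> eventual_period ?g (11 ^ (\<alpha> - 2))" if "\<alpha> \<ge> 2"
  proof
    assume "eventual_period ?g (11 ^ (\<alpha> - 2))"
    then obtain N' where N': "?g (n + 11 ^ (\<alpha> - 2)) = ?g n" if "n \<ge> N'" for n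
      unfolding eventual_period_def by auto
    obtain c N where c: "\<not> 11 dvd c" and N: "11 ^ (\<alpha> - 2 + 2) dvd
        int (num_free_subgroups (n + 11 ^ (\<alpha> - 2))) - int (num_free_subgroups n) + 11 ^ (\<alpha> - 2 + 1) * c"
      if "n \<ge> N" for n using num_free_subgroups_shift[of "\<alpha> - 2"] by metis
    define n where "n = max N N'"
    have e: "\<alpha> - 2 + 2 = \<alpha>" "\<alpha> - 2 + 1 = \<alpha> - 1" using that by auto
    have "11 ^ \<alpha> dvd int (num_free_subgroups (Suc n + 11 ^ (\<alpha> - 2))) - int (num_free_subgroups (Suc n)) + 11 ^ (\<alpha> - 1) * c"
      using N[of "Suc n"] unfolding e by (simp add: n_def)
    moreover have "11 ^ \<alpha> dvd int (num_free_subgroups (Suc n + 11 ^ (\<alpha> - 2))) - int (num_free_subgroups (Suc n))"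
      using N'[of n] unfolding g_eq by (simp add: n_def)
    ultimately have "(11 :: int) ^ \<alpha> dvd 11 ^ (\<alpha> - 1) * c" by (simp add: dvd_add_right_iff)
    moreover have "(11 :: int) ^ \<alpha> = 11 ^ (\<alpha> - 1) * 11" using assms by (simp add: power_eq_if)
    ultimately show False using c[of N] by simp
  qed
  let ?p = "minimal_period ?g"
  have p: "eventual_period ?g ?p" "?p dvd 11 ^ (\<alpha> - 1)" using minimal_period_dvd[OF per] by auto
  \<comment> \<open>The minimal period divides 11^(\<alpha> - 1) and is therefore a power of 11. If
    it were a proper divisor, its multiple 11^(\<alpha> - 2) would be a period, against
    \<open>not_per\<close>; for \<alpha> = 1 there is no proper divisor.\<close>
  obtain k where k: "k \<le> \<alpha> - 1" "?p = 11 ^ k" using p(2) divides_primepow_nat[OF prime_11] by blast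
  show "?p = 11 ^ (\<alpha> - 1)"
  proof (rule ccontr)
    assume "?p \<noteq> 11 ^ (\<alpha> - 1)"
    then have lt: "k \<le> \<alpha> - 2" "\<alpha> \<ge> 2" using k by (cases "k = \<alpha> - 1"; simp)+
    have "(11 :: nat) ^ (\<alpha> - 2) = 11 ^ (\<alpha> - 2 - k) * ?p" using lt k(2) by (simp flip: power_add)
    then show False using not_per[OF lt(2)] eventual_period_mult[OF p(1), of "11 ^ (\<alpha> - 2 - k)"] by simp
  qed
qed

end
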